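(* Let $M$ be a $2m$-dimensional manifold in the image of the generalized supergravity r-map described by a homogeneous function $h$ of degree $D\in\mathbb{R}^{>0}\setminus\{1\}$. Then the Riemann, Ricci and scalar curvature in the holomorphic coordinates $(z^\mu)=(y^\mu+ix^\mu)$ are given by $$R^\rho_{\ \sigma\mu\bar{\nu}}=-\frac{1}{4h^2}\Big[-h^2h^\rho_{\ \sigma\mu\nu}+\frac{1}{D-1}x^\rho(h h_{\sigma\mu\nu}-h_{\mu\sigma}h_\nu)+h_\mu h_\nu\delta_\sigma^\rho+h_\sigma h_\nu\delta_\mu^\rho-h\Big(h_{\sigma\nu}\delta^\rho_\mu+h_{\mu\nu}\delta_\sigma^\rho-\frac{1}{D-1}h_{\mu\sigma}\delta_\nu^\rho\Big)-h^2h^\rho_{\ \nu\beta}h^\beta_{\ \sigma\mu}\Big],$$ $$Ric_{\mu\bar{\nu}}=-m\,g_{\mu\bar{\nu}}+\frac14 h_\mu^{\ \alpha\beta}h_{\alpha\beta\nu}+\frac14 h^\rho_{\ \rho\mu\nu},$$ $$scal=-m^2+\frac{D-2}{D-1}m+h\,h_{\alpha\beta\gamma}h^{\alpha\beta\gamma}+h\,h^{\mu\nu}_{\ \ \mu\nu},$$ where the argument of $h$ and its derivatives is always $x$, indices are raised and lowered with the metric $-\partial^2h$, and sums over repeated indices are implied.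
   Context: Generalized supergravity r-map. Let $U\subset\mathbb{R}^{n+1}$ be a domain invariant under multiplication by positive numbers and $h:U\to\mathbb{R}^{>0}$ a smooth function homogeneous of degree $D\in\mathbb{R}^{>0}\setminus\{1\}$. Assume that $-\partial^2h$ induces (by restriction to $T\mathcal{H}\times T\mathcal{H}$) a Riemannian metric $g_{\mathcal{H}}$ on the smooth hypersurface $\mathcal{H}:=\{x\in U\mid h(x)=1\}$. Put $m:=n+1$ and $M:=\mathbb{R}^{n+1}+iU\subset\mathbb{C}^{n+1}$ with the standard complex structure and standard holomorphic coordinates $z^\mu=y^\mu+ix^\mu$, $\mu=1,\dots,n+1$, where $x=(x^\mu)\in U$, $y=(y^\mu)\in\mathbb{R}^{n+1}$. Endow $M$ with the Kähler metric $$g_M=2g_{\mu\bar\nu}\,dz^\mu d\bar z^\nu,\qquad g_{\mu\bar\nu}:=\frac{\partial^2K}{\partial z^\mu\partial\bar z^\nu}=-\frac{h_{\mu\nu}(x)}{4h(x)}+\frac{h_\mu(x)h_\nu(x)}{4h(x)^2},\qquad K(z,\bar z)=-\log h(x).$$ The correspondence $(\mathcal{H},g_{\mathcal{H}})\mapsto(M,g_M)$ is the generalized supergravity r-map. Notation. $h_\mu=\partial h/\partial x^\mu$, $h_{\mu\nu}=\partial^2h/\partial x^\mu\partial x^\nu$, and similarly $h_{\mu\nu\rho}$, $h_{\mu\nu\rho\sigma}$. Let $h^{\mu\nu}$ (two upper indices, only in this definition) denote the entries of the inverse of the matrix $(h_{\mu\nu})$. Raising an index with the metric $-\partial^2h$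 means contracting with $-h^{\mu\nu}$; e.g. $h^\rho_{\ \sigma\mu}=-h^{\rho\kappa}h_{\kappa\sigma\mu}$, $h^\rho_{\ \sigma\mu\nu}=-h^{\rho\kappa}h_{\kappa\sigma\mu\nu}$, $h_\mu^{\ \alpha\beta}=h^{\alpha\rho}h^{\beta\sigma}h_{\mu\rho\sigma}$, $h^{\alpha\beta\gamma}=-h^{\alpha\rho}h^{\beta\sigma}h^{\gamma\tau}h_{\rho\sigma\tau}$, $h^{\mu\nu}_{\ \ \mu\nu}=h^{\mu\alpha}h^{\nu\beta}h_{\alpha\beta\mu\nu}$. Curvature conventions. With $\nabla$ the Levi-Civita connection and $R(X,Y)Z=\nabla_X\nabla_YZ-\nabla_Y\nabla_XZ-\nabla_{[X,Y]}Z$ (extended complex linearly), $R^\rho_{\ \sigma\mu\bar\nu}:=dz^\rho\big(R(\partial_{z^\mu},\partial_{\bar z^\nu})\partial_{z^\sigma}\big)$, $Ric_{\mu\bar\nu}:=R^\rho_{\ \mu\rho\bar\nu}$, and $scal:=g^{\mu\bar\nu}Ric_{\mu\bar\nu}$, where $(g^{\bar\nu\lambda})$ is the inverse matrix of $(g_{\mu\bar\nu})$; thus $scal$ is one half of the usual Riemannian scalar curvature. *)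

theory Defs
  imports "HOL-Analysis.Analysis"
begin

section \<open>Smooth maps and the Levi-Civita connection on open subsets of a Euclidean space\<close>

text \<open>Over an open subset of a finite-dimensional space, \<open>Ck k S f\<close> says that all iterated directional
  derivatives of \<open>f\<close> of order up to \<open>k\<close> exist and are continuous on \<open>S\<close>.\<close>

primrec Ck :: "nat \<Rightarrow> 'a::real_normed_vector set \<Rightarrow> ('a \<Rightarrow> 'b::real_normed_vector) \<Rightarrow> bool" where
  "Ck 0 S = (\<lambda>f. continuous_on S f)"
| "Ck (Suc k) S = (\<lambda>f. (\<forall>x\<in>S. f differentiable (at x)) \<and>
      (\<forall>v. Ck k S (\<lambda>x. frechet_derivative f (at x) v)))"

definition smooth_on :: "'a::real_normed_vector set \<Rightarrow> ('a \<Rightarrow> 'b::real_normed_vector) \<Rightarrow> bool" where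
  "smooth_on S f \<longleftrightarrow> (\<forall>k. Ck k S f)"

text \<open>A vector field on an open set \<open>M\<close> is a map \<open>'a \<Rightarrow> 'a\<close> of which only the values on \<open>M\<close> matter.
  \<open>vderiv X f\<close> is the derivative of the (scalar or vector valued) function \<open>f\<close> along \<open>X\<close>.\<close>

definition vderiv :: "('a::real_normed_vector \<Rightarrow> 'a) \<Rightarrow> ('a \<Rightarrow> 'b::real_normed_vector) \<Rightarrow> 'a \<Rightarrow> 'b" where
  "vderiv X f p = frechet_derivative f (at p) (X p)"

definition lie_bracket :: "('a::real_normed_vector \<Rightarrow> 'a) \<Rightarrow> ('a \<Rightarrow> 'a) \<Rightarrow> 'a \<Rightarrow> 'a" where
  "lie_bracket X Y p = vderiv X Y p - vderiv Y X p"

definition affine_connection_on ::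
    "'a::euclidean_space set \<Rightarrow> (('a \<Rightarrow> 'a) \<Rightarrow> ('a \<Rightarrow> 'a) \<Rightarrow> 'a \<Rightarrow> 'a) \<Rightarrow> bool" where
  "affine_connection_on M nabla \<longleftrightarrow>
     (\<forall>X Y. smooth_on M X \<and> smooth_on M Y \<longrightarrow> smooth_on M (nabla X Y)) \<and>
     (\<forall>X X' Y. smooth_on M X \<and> smooth_on M X' \<and> smooth_on M Y \<longrightarrow>
        (\<forall>p\<in>M. nabla (\<lambda>q. X q + X' q) Y p = nabla X Y p + nabla X' Y p)) \<and>
     (\<forall>f X Y. smooth_on M (f :: 'a \<Rightarrow> real) \<and> smooth_on M X \<and> smooth_on M Y \<longrightarrow>
        (\<forall>p\<in>M. nabla (\<lambda>q. f q *\<^sub>R X q) Y p = f p *\<^sub>R nabla X Y p)) \<and>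
     (\<forall>X Y Y'. smooth_on M X \<and> smooth_on M Y \<and> smooth_on M Y' \<longrightarrow>
        (\<forall>p\<in>M. nabla X (\<lambda>q. Y q + Y' q) p = nabla X Y p + nabla X Y' p)) \<and>
     (\<forall>f X Y. smooth_on M (f :: 'a \<Rightarrow> real) \<and> smooth_on M X \<and> smooth_on M Y \<longrightarrow>
        (\<forall>p\<in>M. nabla X (\<lambda>q. f q *\<^sub>R Y q) p = vderiv X f p *\<^sub>R Y p + f p *\<^sub>R nabla X Y p))"

definition levi_civita_on ::
    "'a::euclidean_space set \<Rightarrow> ('a \<Rightarrow> 'a \<Rightarrow> 'a \<Rightarrow> real) \<Rightarrow>
     (('a \<Rightarrow> 'a) \<Rightarrow> ('a \<Rightarrow> 'a) \<Rightarrow> 'a \<Rightarrow> 'a) \<Rightarrow> bool" where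
  "levi_civita_on M g nabla \<longleftrightarrow>
     affine_connection_on M nabla \<and>
     (\<forall>X Y. smooth_on M X \<and> smooth_on M Y \<longrightarrow>
        (\<forall>p\<in>M. nabla X Y p - nabla Y X p = lie_bracket X Y p)) \<and>
     (\<forall>X Y Z. smooth_on M X \<and> smooth_on M Y \<and> smooth_on M Z \<longrightarrow>
        (\<forall>p\<in>M. vderiv X (\<lambda>q. g q (Y q) (Z q)) p
                 = g p (nabla X Y p) (Z p) + g p (Y p) (nabla X Z p)))"

definition curvature ::
    "(('a::euclidean_space \<Rightarrow> 'a) \<Rightarrow> ('a \<Rightarrow> 'a) \<Rightarrow> 'a \<Rightarrow> 'a) \<Rightarrow>
     ('a \<Rightarrow> 'a) \<Rightarrow> ('a \<Rightarrow> 'a) \<Rightarrow> ('a \<Rightarrow> 'a) \<Rightarrow> 'a \<Rightarrow> 'a" where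
  "curvature nabla X Y Z p =
     nabla X (nabla Y Z) p - nabla Y (nabla X Z) p - nabla (lie_bracket X Y) Z p"

text \<open>A complex vector field is encoded by a pair \<open>(A, B)\<close> of real vector fields, standing for
  \<open>A \<otimes> 1 + B \<otimes> i\<close>. Note that this \<open>i\<close> is the one of the complexification, not the complex
  structure of the underlying manifold. The following is the complex trilinear extension
  of the curvature.\<close>

fun curvature_complexified ::
    "(('a::euclidean_space \<Rightarrow> 'a) \<Rightarrow> ('a \<Rightarrow> 'a) \<Rightarrow> 'a \<Rightarrow> 'a) \<Rightarrow>
     ('a \<Rightarrow> 'a) \<times> ('a \<Rightarrow> 'a) \<Rightarrow> ('a \<Rightarrow> 'a) \<times> ('a \<Rightarrow> 'a) \<Rightarrow> ('a \<Rightarrow> 'a) \<times> ('a \<Rightarrow> 'a) \<Rightarrow> 'a \<Rightarrow> 'a \<times> 'a" where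
  "curvature_complexified nabla (X, X') (Y, Y') (Z, Z') p =
     (let R = (\<lambda>U V W. curvature nabla U V W p) in
      (R X Y Z - R X' Y' Z - R X' Y Z' - R X Y' Z',
       R X' Y Z + R X Y' Z + R X Y Z' - R X' Y' Z'))"


section \<open>Holomorphic coordinates on open subsets of complex coordinate space\<close>

text \<open>The coordinates are \<open>z $ \<mu> = y $ \<mu> + \<i> * x $ \<mu>\<close>, so that \<open>axis \<mu> 1\<close> and \<open>axis \<mu> \<i>\<close> are the
  real coordinate fields of \<open>y $ \<mu>\<close> and \<open>x $ \<mu>\<close>. First the derivations of complex valued functions.\<close>

definition d_z :: "'m::finite \<Rightarrow> (complex^'m \<Rightarrow> complex) \<Rightarrow> complex^'m \<Rightarrow> complex" where
  "d_z \<mu> f z = (frechet_derivative f (at z) (axis \<mu> 1)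
                - \<i> * frechet_derivative f (at z) (axis \<mu> \<i>)) / 2"

definition d_zbar :: "'m::finite \<Rightarrow> (complex^'m \<Rightarrow> complex) \<Rightarrow> complex^'m \<Rightarrow> complex" where
  "d_zbar \<mu> f z = (frechet_derivative f (at z) (axis \<mu> 1)
                + \<i> * frechet_derivative f (at z) (axis \<mu> \<i>)) / 2"

text \<open>The same derivations as complex vector fields, and the complex linear extension of \<open>dz\<close>.\<close>

definition field_z :: "'m::finite \<Rightarrow> (complex^'m \<Rightarrow> complex^'m) \<times> (complex^'m \<Rightarrow> complex^'m)" where
  "field_z \<mu> = ((\<lambda>_. (1/2) *\<^sub>R axis \<mu> 1), (\<lambda>_. - (1/2) *\<^sub>R axis \<mu> \<i>))"

definition field_zbar :: "'m::finite \<Rightarrow> (complex^'m \<Rightarrow> complex^'m) \<times> (complex^'m \<Rightarrow> complex^'m)" where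
  "field_zbar \<mu> = ((\<lambda>_. (1/2) *\<^sub>R axis \<mu> 1), (\<lambda>_. (1/2) *\<^sub>R axis \<mu> \<i>))"

definition dz :: "'m::finite \<Rightarrow> (complex^'m) \<times> (complex^'m) \<Rightarrow> complex" where
  "dz \<rho> w = fst w $ \<rho> + \<i> * (snd w $ \<rho>)"

text \<open>\<open>Riem nabla \<rho> \<sigma> \<mu> \<nu>\<close> is the component with upper index \<open>\<rho>\<close> and lower indices \<open>\<sigma>\<close>, \<open>\<mu>\<close> and
  \<open>\<nu>\<close>-bar.\<close>

definition Riem ::
    "((complex^'m \<Rightarrow> complex^'m) \<Rightarrow> (complex^'m \<Rightarrow> complex^'m) \<Rightarrow> complex^'m \<Rightarrow> complex^'m) \<Rightarrow>
     'm::finite \<Rightarrow> 'm \<Rightarrow> 'm \<Rightarrow> 'm \<Rightarrow> complex^'m \<Rightarrow> complex" where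
  "Riem nabla \<rho> \<sigma> \<mu> \<nu> z =
     dz \<rho> (curvature_complexified nabla (field_z \<mu>) (field_zbar \<nu>) (field_z \<sigma>) z)"

definition Ric ::
    "((complex^'m \<Rightarrow> complex^'m) \<Rightarrow> (complex^'m \<Rightarrow> complex^'m) \<Rightarrow> complex^'m \<Rightarrow> complex^'m) \<Rightarrow>
     'm::finite \<Rightarrow> 'm \<Rightarrow> complex^'m \<Rightarrow> complex" where
  "Ric nabla \<mu> \<nu> z = (\<Sum>\<rho>\<in>UNIV. Riem nabla \<rho> \<mu> \<rho> \<nu> z)"

text \<open>For a matrix \<open>G\<close> of components with indices \<open>\<mu>\<close> and \<open>\<nu>\<close>-bar, the rows of the inverse matrix are
  indexed by barred indices. The result is half of the Riemannian scalar curvature.\<close>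

definition scal ::
    "(complex^'m \<Rightarrow> complex^'m^'m) \<Rightarrow>
     ((complex^'m \<Rightarrow> complex^'m) \<Rightarrow> (complex^'m \<Rightarrow> complex^'m) \<Rightarrow> complex^'m \<Rightarrow> complex^'m) \<Rightarrow>
     complex^'m::finite \<Rightarrow> complex" where
  "scal G nabla z = (\<Sum>\<mu>\<in>UNIV. \<Sum>\<nu>\<in>UNIV. matrix_inv (G z) $ \<nu> $ \<mu> * Ric nabla \<mu> \<nu> z)"


section \<open>The generalized supergravity r-map\<close>

definition im_part :: "complex^'m \<Rightarrow> real^'m::finite" where
  "im_part z = (\<chi> \<mu>. Im (z $ \<mu>))"

definition tube_domain :: "(real^'m::finite) set \<Rightarrow> (complex^'m) set" where
  "tube_domain U = {z. im_part z \<in> U}"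

definition kaehler_potential :: "(real^'m::finite \<Rightarrow> real) \<Rightarrow> complex^'m \<Rightarrow> complex" where
  "kaehler_potential h z = complex_of_real (- ln (h (im_part z)))"

definition kaehler_matrix :: "(real^'m::finite \<Rightarrow> real) \<Rightarrow> complex^'m \<Rightarrow> complex^'m^'m" where
  "kaehler_matrix h z = (\<chi> \<mu> \<nu>. d_z \<mu> (d_zbar \<nu> (kaehler_potential h)) z)"

text \<open>The real symmetric bilinear form \<open>2 g\<^bsub>\<mu>\<nu>\<^esub> dz\<^sup>\<mu> dz\<^sup>\<nu>\<close> (second factor conjugated), where the product
  of one-forms is the symmetrized one, \<open>\<alpha> \<beta> = (\<alpha> \<otimes> \<beta> + \<beta> \<otimes> \<alpha>) / 2\<close>. The sum is already real, since
  the coefficient matrix is hermitian.\<close>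

definition r_map_metric ::
    "(real^'m::finite \<Rightarrow> real) \<Rightarrow> complex^'m \<Rightarrow> complex^'m \<Rightarrow> complex^'m \<Rightarrow> real" where
  "r_map_metric h z v w = Re (\<Sum>\<mu>\<in>UNIV. \<Sum>\<nu>\<in>UNIV. kaehler_matrix h z $ \<mu> $ \<nu> *
       (v $ \<mu> * cnj (w $ \<nu>) + w $ \<mu> * cnj (v $ \<nu>)))"

definition pd :: "'m::finite \<Rightarrow> (real^'m \<Rightarrow> real) \<Rightarrow> real^'m \<Rightarrow> real" where
  "pd \<mu> f x = frechet_derivative f (at x) (axis \<mu> 1)"

definition h1 :: "(real^'m::finite \<Rightarrow> real) \<Rightarrow> real^'m \<Rightarrow> 'm \<Rightarrow> real" where
  "h1 h x \<mu> = pd \<mu> h x"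

definition h2 :: "(real^'m::finite \<Rightarrow> real) \<Rightarrow> real^'m \<Rightarrow> 'm \<Rightarrow> 'm \<Rightarrow> real" where
  "h2 h x \<mu> \<nu> = pd \<mu> (pd \<nu> h) x"

definition h3 :: "(real^'m::finite \<Rightarrow> real) \<Rightarrow> real^'m \<Rightarrow> 'm \<Rightarrow> 'm \<Rightarrow> 'm \<Rightarrow> real" where
  "h3 h x \<mu> \<nu> \<rho> = pd \<mu> (pd \<nu> (pd \<rho> h)) x"

definition h4 :: "(real^'m::finite \<Rightarrow> real) \<Rightarrow> real^'m \<Rightarrow> 'm \<Rightarrow> 'm \<Rightarrow> 'm \<Rightarrow> 'm \<Rightarrow> real" where
  "h4 h x \<mu> \<nu> \<rho> \<sigma> = pd \<mu> (pd \<nu> (pd \<rho> (pd \<sigma> h))) x"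

text \<open>\<open>x\<close> lies on the level set \<open>h = 1\<close>; its tangent space there is the kernel of the differential
  of \<open>h\<close>, which is nonzero by Euler's relation for homogeneous functions.\<close>

definition minus_hessian_riemannian_on_level :: "(real^'m::finite) set \<Rightarrow> (real^'m \<Rightarrow> real) \<Rightarrow> bool" where
  "minus_hessian_riemannian_on_level U h \<longleftrightarrow>
     (\<forall>x\<in>U. h x = 1 \<longrightarrow>
        (\<forall>v. frechet_derivative h (at x) v = 0 \<and> v \<noteq> 0 \<longrightarrow>
           - (\<Sum>\<mu>\<in>UNIV. \<Sum>\<nu>\<in>UNIV. h2 h x \<mu> \<nu> * v $ \<mu> * v $ \<nu>) > 0))"

definition hess_inv :: "(real^'m::finite \<Rightarrow> real) \<Rightarrow> real^'m \<Rightarrow> 'm \<Rightarrow> 'm \<Rightarrow> real" where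
  "hess_inv h x \<mu> \<nu> = matrix_inv (\<chi> \<alpha> \<beta>. h2 h x \<alpha> \<beta>) $ \<mu> $ \<nu>"

text \<open>Derivatives of \<open>h\<close> with indices raised by \<open>-\<partial>\<^sup>2h\<close>, i.e. with one factor \<open>- hess_inv\<close> for each
  raised index; the letters \<open>u\<close> and \<open>d\<close> give the positions (upper, lower) of the index arguments.\<close>

definition h_udd :: "(real^'m::finite \<Rightarrow> real) \<Rightarrow> real^'m \<Rightarrow> 'm \<Rightarrow> 'm \<Rightarrow> 'm \<Rightarrow> real" where
  "h_udd h x \<rho> \<sigma> \<mu> = - (\<Sum>\<kappa>\<in>UNIV. hess_inv h x \<rho> \<kappa> * h3 h x \<kappa> \<sigma> \<mu>)"

definition h_uddd :: "(real^'m::finite \<Rightarrow> real) \<Rightarrow> real^'m \<Rightarrow> 'm \<Rightarrow> 'm \<Rightarrow> 'm \<Rightarrow> 'm \<Rightarrow> real" where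
  "h_uddd h x \<rho> \<sigma> \<mu> \<nu> = - (\<Sum>\<kappa>\<in>UNIV. hess_inv h x \<rho> \<kappa> * h4 h x \<kappa> \<sigma> \<mu> \<nu>)"

definition h_duu :: "(real^'m::finite \<Rightarrow> real) \<Rightarrow> real^'m \<Rightarrow> 'm \<Rightarrow> 'm \<Rightarrow> 'm \<Rightarrow> real" where
  "h_duu h x \<mu> \<alpha> \<beta> =
     (\<Sum>\<rho>\<in>UNIV. \<Sum>\<sigma>\<in>UNIV. hess_inv h x \<alpha> \<rho> * hess_inv h x \<beta> \<sigma> * h3 h x \<mu> \<rho> \<sigma>)"

definition h_uuu :: "(real^'m::finite \<Rightarrow> real) \<Rightarrow> real^'m \<Rightarrow> 'm \<Rightarrow> 'm \<Rightarrow> 'm \<Rightarrow> real" where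
  "h_uuu h x \<alpha> \<beta> \<gamma> =
     - (\<Sum>\<rho>\<in>UNIV. \<Sum>\<sigma>\<in>UNIV. \<Sum>\<tau>\<in>UNIV.
          hess_inv h x \<alpha> \<rho> * hess_inv h x \<beta> \<sigma> * hess_inv h x \<gamma> \<tau> * h3 h x \<rho> \<sigma> \<tau>)"

definition h_uudd :: "(real^'m::finite \<Rightarrow> real) \<Rightarrow> real^'m \<Rightarrow> 'm \<Rightarrow> 'm \<Rightarrow> 'm \<Rightarrow> 'm \<Rightarrow> real" where
  "h_uudd h x \<mu> \<nu> \<rho> \<sigma> =
     (\<Sum>\<alpha>\<in>UNIV. \<Sum>\<beta>\<in>UNIV. hess_inv h x \<mu> \<alpha> * hess_inv h x \<nu> \<beta> * h4 h x \<alpha> \<beta> \<rho> \<sigma>)"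

definition kron :: "'m \<Rightarrow> 'm \<Rightarrow> real" where
  "kron \<mu> \<nu> = (if \<mu> = \<nu> then 1 else 0)"

end

theory Submission
  imports Defs
begin

text \<open>With \<open>K = - ln h\<close>, the components of the metric are \<open>K\<^bsub>\<mu>\<nu>\<^esub> / 4\<close> and depend on \<open>x\<close> only, so every
  \<open>\<partial>/\<partial>z\<^sup>\<mu>\<close> or its conjugate acts as a multiple \<open>\<mp>\<i>/2\<close> of \<open>\<partial>\<^sub>\<mu>\<close>. The Koszul formula then gives
  \<open>\<nabla>\<^sub>u v = - (\<i>/2) P(u, v)\<close> for constant fields, where \<open>P\<close> is complex bilinear with coefficients
  \<open>K\<^sup>\<rho>\<^sup>\<tau> K\<^bsub>\<tau>\<mu>\<sigma>\<^esub>\<close>, and the mixed curvature components are \<open>- 1/4 \<partial>\<^sub>\<nu> P\<^sup>\<rho>\<^bsub>\<mu>\<sigma>\<^esub>\<close>. Euler's relations for the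
  homogeneous functions \<open>h\<close>, \<open>h\<^sub>\<mu>\<close>, \<open>h\<^bsub>\<mu>\<nu>\<^esub>\<close>, \<open>h\<^bsub>\<mu>\<nu>\<rho>\<^esub>\<close> yield
  \<open>K\<^sup>\<mu>\<^sup>\<nu> = - h h\<^sup>\<mu>\<^sup>\<nu> + x\<^sup>\<mu> x\<^sup>\<nu> / (D - 1)\<close> and a closed form of \<open>P\<close> in terms of \<open>h\<close>, from which the three
  formulas follow by differentiation and contraction.\<close>

section \<open>Partial derivatives\<close>

text \<open>The hypothesis makes \<open>- h2\<close> definite only on tangent spaces of the level
  set h = 1, so an inverse Hessian has to be earned. Euler's relation makes x orthogonal, with
  respect to the Hessian, to the kernel of dh, and the value D (D - 1) h of the Hessian at (x, x) is
  nonzero. The same relation says that \<open>hess_inv\<close> maps dh to x / (D - 1); inverting the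
  matrix \<open>K2\<close>, a rank-one change of \<open>- h2 / h\<close>, then only adds a multiple
  of x x. The connection \<open>nabla\<close> is an arbitrary operator subject to the axioms. It is
  pinned down by pairing with constant fields, which is enough because \<open>K2\<close> is
  nondegenerate. The curvature applies \<open>nabla\<close> to \<open>nabla Y Z\<close>, which is
  not constant, so the formula for a constant direction and an arbitrary smooth field is needed as
  well. The terms quadratic in P drop out of the mixed components because they are complex trilinear
  and a barred coordinate field has no (1,0) part. Symmetry of second derivatives is proved for
  directional derivatives because \<open>smooth_on\<close> supplies exactly those.\<close>

lemma has_real_derivative_along_line:
  fixes f :: "'a::real_normed_vector \<Rightarrow> real"
  assumes "f differentiable (at (a + s *\<^sub>R u))"
  shows "((\<lambda>s. f (a + s *\<^sub>R u)) has_real_derivative frechet_derivative f (at (a + s *\<^sub>R u)) u) (at s)"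
proof -
  let ?f' = "frechet_derivative f (at (a + s *\<^sub>R u))"
  have f': "(f has_derivative ?f') (at (a + s *\<^sub>R u))"
    using assms frechet_derivative_works by blast
  have line: "((\<lambda>s. a + s *\<^sub>R u) has_derivative (\<lambda>s. s *\<^sub>R u)) (at s)"
    by (auto intro!: derivative_eq_intros)
  have "((\<lambda>s. f (a + s *\<^sub>R u)) has_derivative (\<lambda>t. ?f' (t *\<^sub>R u))) (at s)"
    using has_derivative_compose[OF line f'] .
  moreover have "?f' (t *\<^sub>R u) = ?f' u * t" for t
    using linear_scale[OF has_derivative_linear[OF f'], of t u] by simp
  ultimately show ?thesis
    by (simp add: has_field_derivative_def)
qed

text \<open>The mean value theorem is applied twice: along u to the increment of f by
  \<open>r *\<^sub>R v\<close>, then along v to the derivative in direction u. The left-hand side is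
  symmetric in u and v, so exchanging their roles expresses the same number by the other mixed
  derivative.\<close>

lemma second_difference_mvt:
  fixes f :: "'a::real_normed_vector \<Rightarrow> real"
  assumes r: "r > 0"
    and S: "\<And>s t. 0 \<le> s \<Longrightarrow> s \<le> r \<Longrightarrow> 0 \<le> t \<Longrightarrow> t \<le> r \<Longrightarrow> p + s *\<^sub>R u + t *\<^sub>R v \<in> S"
    and f: "\<And>q. q \<in> S \<Longrightarrow> f differentiable (at q)"
    and fu: "\<And>q. q \<in> S \<Longrightarrow> (\<lambda>q. frechet_derivative f (at q) u) differentiable (at q)"
  shows "\<exists>s t. 0 \<le> s \<and> s \<le> r \<and> 0 \<le> t \<and> t \<le> r \<and>
     f (p + r *\<^sub>R u + r *\<^sub>R v) - f (p + r *\<^sub>R u) - f (p + r *\<^sub>R v) + f p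
       = r\<^sup>2 * frechet_derivative (\<lambda>q. frechet_derivative f (at q) u) (at (p + s *\<^sub>R u + t *\<^sub>R v)) v"
proof -
  let ?fu = "\<lambda>q. frechet_derivative f (at q) u"
  define \<phi> where "\<phi> s = f ((p + r *\<^sub>R v) + s *\<^sub>R u) - f (p + s *\<^sub>R u)" for s
  have "(\<phi> has_real_derivative ?fu ((p + r *\<^sub>R v) + s *\<^sub>R u) - ?fu (p + s *\<^sub>R u)) (at s)"
    if "0 \<le> s" "s \<le> r" for s
    unfolding \<phi>_def using that r S[of s r] S[of s 0]
    by (intro DERIV_diff has_real_derivative_along_line f) (simp_all add: ac_simps)
  from MVT2[OF r, of \<phi>, OF this] obtain s where s: "0 < s" "s < r"
    and eq1: "\<phi> r - \<phi> 0 = r * (?fu ((p + r *\<^sub>R v) + s *\<^sub>R u) - ?fu (p + s *\<^sub>R u))"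
    by auto
  have "((\<lambda>t. ?fu ((p + s *\<^sub>R u) + t *\<^sub>R v)) has_real_derivative
       frechet_derivative ?fu (at ((p + s *\<^sub>R u) + t *\<^sub>R v)) v) (at t)"
    if "0 \<le> t" "t \<le> r" for t
    using that s S[of s t] by (intro has_real_derivative_along_line fu) simp
  from MVT2[OF r this] obtain t where t: "0 < t" "t < r"
    and eq2: "?fu ((p + s *\<^sub>R u) + r *\<^sub>R v) - ?fu ((p + s *\<^sub>R u) + 0 *\<^sub>R v)
              = (r - 0) * frechet_derivative ?fu (at ((p + s *\<^sub>R u) + t *\<^sub>R v)) v"
    by auto
  have "f (p + r *\<^sub>R u + r *\<^sub>R v) - f (p + r *\<^sub>R u) - f (p + r *\<^sub>R v) + f p = \<phi> r - \<phi> 0"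
    by (simp add: \<phi>_def algebra_simps)
  also have "\<dots> = r\<^sup>2 * frechet_derivative ?fu (at (p + s *\<^sub>R u + t *\<^sub>R v)) v"
    using eq1 eq2 by (simp add: power2_eq_square algebra_simps)
  finally show ?thesis
    using s t by (intro exI[of _ s] exI[of _ t]) auto
qed

text \<open>Schwarz's theorem. On a small parallelogram at p the second difference equals r^2 times
  either mixed derivative at some point; if the two derivatives differed at p, continuity would keep
  them apart on the whole parallelogram.\<close>

lemma frechet_derivative_commute:
  fixes f :: "'a::real_normed_vector \<Rightarrow> real"
  assumes "open S" "p \<in> S"
    and f: "\<And>q. q \<in> S \<Longrightarrow> f differentiable (at q)"
    and fu: "\<And>q. q \<in> S \<Longrightarrow> (\<lambda>q. frechet_derivative f (at q) u) differentiable (at q)"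
    and fv: "\<And>q. q \<in> S \<Longrightarrow> (\<lambda>q. frechet_derivative f (at q) v) differentiable (at q)"
    and cuv: "continuous_on S (\<lambda>q. frechet_derivative (\<lambda>q. frechet_derivative f (at q) u) (at q) v)"
    and cvu: "continuous_on S (\<lambda>q. frechet_derivative (\<lambda>q. frechet_derivative f (at q) v) (at q) u)"
  shows "frechet_derivative (\<lambda>q. frechet_derivative f (at q) u) (at p) v
       = frechet_derivative (\<lambda>q. frechet_derivative f (at q) v) (at p) u"
proof (rule ccontr)
  let ?F = "\<lambda>q. frechet_derivative (\<lambda>q. frechet_derivative f (at q) u) (at q) v"
  let ?G = "\<lambda>q. frechet_derivative (\<lambda>q. frechet_derivative f (at q) v) (at q) u"
  assume neq: "?F p \<noteq> ?G p"
  define e where "e = \<bar>?F p - ?G p\<bar> / 2"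
  have e: "e > 0" using neq by (simp add: e_def)
  obtain d0 where d0: "d0 > 0" "ball p d0 \<subseteq> S"
    using assms(1,2) openE by blast
  obtain d1 where d1: "d1 > 0" "\<And>q. q \<in> S \<Longrightarrow> dist q p < d1 \<Longrightarrow> dist (?F q) (?F p) < e"
    using cuv assms(2) e unfolding continuous_on_iff by metis
  obtain d2 where d2: "d2 > 0" "\<And>q. q \<in> S \<Longrightarrow> dist q p < d2 \<Longrightarrow> dist (?G q) (?G p) < e"
    using cvu assms(2) e unfolding continuous_on_iff by metis
  define d where "d = min d0 (min d1 d2)"
  have d: "d > 0" "d \<le> d0" "d \<le> d1" "d \<le> d2" using d0 d1 d2 by (auto simp: d_def)
  \<comment> \<open>This size keeps the parallelogram with sides \<open>r *\<^sub>R u\<close> and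
    \<open>r *\<^sub>R v\<close> within distance d of p; the summand 1 covers the case u = v =
    0.\<close>
  define r where "r = d / (norm u + norm v + 1)"
  have r: "r > 0"
    unfolding r_def using d(1) by (intro divide_pos_pos) (auto intro: add_nonneg_pos)
  \<comment> \<open>The norm condition is symmetric, so the bound serves both orders (u, v) and (v,
    u).\<close>
  have near: "dist (p + s *\<^sub>R a + t *\<^sub>R b) p < d"
    if "0 \<le> s" "s \<le> r" "0 \<le> t" "t \<le> r" "norm a + norm b = norm u + norm v" for s t a b
  proof -
    have "dist (p + s *\<^sub>R a + t *\<^sub>R b) p = norm (s *\<^sub>R a + t *\<^sub>R b)"
      by (simp add: dist_norm)
    also have "\<dots> \<le> s * norm a + t * norm b"
      using norm_triangle_ineq[of "s *\<^sub>R a" "t *\<^sub>R b"] that by simp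
    also have "\<dots> \<le> r * norm a + r * norm b"
      using that by (intro add_mono mult_right_mono) auto
    also have "\<dots> = r * (norm u + norm v)"
      using that by (simp add: distrib_left[symmetric])
    also have "\<dots> < r * (norm u + norm v + 1)"
      using r by simp
    also have "\<dots> = d"
      using add_nonneg_pos[of "norm u + norm v" 1] unfolding r_def by simp
    finally show ?thesis .
  qed
  have inS: "p + s *\<^sub>R a + t *\<^sub>R b \<in> S"
    if "0 \<le> s" "s \<le> r" "0 \<le> t" "t \<le> r" "norm a + norm b = norm u + norm v" for s t a b
    using near[OF that] d d0 by (auto simp: subset_eq dist_commute)
  have inS_uv: "p + s *\<^sub>R u + t *\<^sub>R v \<in> S" and inS_vu: "p + s *\<^sub>R v + t *\<^sub>R u \<in> S"
    if "0 \<le> s" "s \<le> r" "0 \<le> t" "t \<le> r" for s t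
    using inS[OF that, of u v] inS[OF that, of v u] by simp_all
  have "\<exists>s t. 0 \<le> s \<and> s \<le> r \<and> 0 \<le> t \<and> t \<le> r \<and>
    f (p + r *\<^sub>R u + r *\<^sub>R v) - f (p + r *\<^sub>R u) - f (p + r *\<^sub>R v) + f p
       = r\<^sup>2 * ?F (p + s *\<^sub>R u + t *\<^sub>R v)"
    by (rule second_difference_mvt[OF r, where S = S]; (rule inS_uv f fu; assumption))
  then obtain s t where st: "0 \<le> s" "s \<le> r" "0 \<le> t" "t \<le> r"
    "f (p + r *\<^sub>R u + r *\<^sub>R v) - f (p + r *\<^sub>R u) - f (p + r *\<^sub>R v) + f p
       = r\<^sup>2 * ?F (p + s *\<^sub>R u + t *\<^sub>R v)"
    by (elim exE conjE)
  have "\<exists>s t. 0 \<le> s \<and> s \<le> r \<and> 0 \<le> t \<and> t \<le> r \<and>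
    f (p + r *\<^sub>R v + r *\<^sub>R u) - f (p + r *\<^sub>R v) - f (p + r *\<^sub>R u) + f p
       = r\<^sup>2 * ?G (p + s *\<^sub>R v + t *\<^sub>R u)"
    by (rule second_difference_mvt[OF r, where S = S]; (rule inS_vu f fv; assumption))
  then obtain s' t' where st': "0 \<le> s'" "s' \<le> r" "0 \<le> t'" "t' \<le> r"
    "f (p + r *\<^sub>R v + r *\<^sub>R u) - f (p + r *\<^sub>R v) - f (p + r *\<^sub>R u) + f p
       = r\<^sup>2 * ?G (p + s' *\<^sub>R v + t' *\<^sub>R u)"
    by (elim exE conjE)
  have "r\<^sup>2 * ?F (p + s *\<^sub>R u + t *\<^sub>R v) = r\<^sup>2 * ?G (p + s' *\<^sub>R v + t' *\<^sub>R u)"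
    unfolding st(5)[symmetric] st'(5)[symmetric] by (simp add: ac_simps)
  then have FG: "?F (p + s *\<^sub>R u + t *\<^sub>R v) = ?G (p + s' *\<^sub>R v + t' *\<^sub>R u)"
    using r by simp
  have "dist (?F (p + s *\<^sub>R u + t *\<^sub>R v)) (?F p) < e"
    using st(1-4) by (intro d1(2) inS less_le_trans[OF near d(3)]) auto
  moreover have "dist (?G (p + s' *\<^sub>R v + t' *\<^sub>R u)) (?G p) < e"
    using st'(1-4) by (intro d2(2) inS less_le_trans[OF near d(4)]) auto
  ultimately have "\<bar>?F p - ?G p\<bar> < 2 * e"
    unfolding FG dist_real_def by linarith
  then show False by (simp add: e_def)
qed

section \<open>Smooth functions and the calculus of partial derivatives\<close>

lemma Ck_const: "Ck k S (\<lambda>_. c)"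
proof (induction k arbitrary: c)
  case (Suc k)
  then show ?case
    by (simp add: frechet_derivative_const)
qed simp

lemma smooth_on_const: "smooth_on S (\<lambda>_. c)"
  by (simp add: smooth_on_def Ck_const)

lemma smooth_on_differentiable: "smooth_on S f \<Longrightarrow> p \<in> S \<Longrightarrow> f differentiable (at p)"
  unfolding smooth_on_def by (drule spec[of _ "Suc 0"]) simp

lemma smooth_on_continuous: "smooth_on S f \<Longrightarrow> continuous_on S f"
  unfolding smooth_on_def by (drule spec[of _ 0]) simp

lemma smooth_on_frechet_derivative:
  "smooth_on S f \<Longrightarrow> smooth_on S (\<lambda>x. frechet_derivative f (at x) v)"
  unfolding smooth_on_def
proof
  fix k assume "\<forall>k. Ck k S f"
  then have "Ck (Suc k) S f" ..
  then show "Ck k S (\<lambda>x. frechet_derivative f (at x) v)" by simp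
qed

lemma smooth_on_pd: "smooth_on S f \<Longrightarrow> smooth_on S (pd \<mu> f)"
  unfolding pd_def[abs_def] by (rule smooth_on_frechet_derivative)

lemma pd_commute:
  assumes "open S" "smooth_on S f" "x \<in> S"
  shows "pd \<mu> (pd \<nu> f) x = pd \<nu> (pd \<mu> f) x"
  unfolding pd_def[abs_def] using assms
  by - (rule frechet_derivative_commute[where S = S]; (assumption | rule smooth_on_continuous
     smooth_on_frechet_derivative | rule smooth_on_differentiable[where S = S])+)

lemma frechet_derivative_eqI: "(f has_derivative f') (at x) \<Longrightarrow> frechet_derivative f (at x) = f'"
  by (rule frechet_derivative_at[symmetric])

lemma pd_eqI: "(f has_derivative f') (at x) \<Longrightarrow> pd \<mu> f x = f' (axis \<mu> 1)"
  by (simp add: pd_def frechet_derivative_eqI)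

lemma differentiable_has_derivative:
  "f differentiable (at x) \<Longrightarrow> (f has_derivative frechet_derivative f (at x)) (at x)"
  using frechet_derivative_works by blast

text \<open>Both functions satisfy the same \<open>has_derivative\<close> statements at x, so the
  choice hidden in \<open>frechet_derivative\<close> picks the same map, whether or not a derivative
  exists.\<close>

lemma frechet_derivative_cong_open:
  assumes "open S" "x \<in> S" "\<And>y. y \<in> S \<Longrightarrow> f y = g y"
  shows "frechet_derivative f (at x) = frechet_derivative g (at x)"
proof -
  have "(f has_derivative f') (at x) = (g has_derivative f') (at x)" for f'
  proof
    show "(g has_derivative f') (at x)" if "(f has_derivative f') (at x)"
      by (rule has_derivative_transform_within_open[OF that assms(1,2)]) (rule assms(3))
    show "(f has_derivative f') (at x)" if "(g has_derivative f') (at x)"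
      by (rule has_derivative_transform_within_open[OF that assms(1,2)]) (rule assms(3)[symmetric])
  qed
  then show ?thesis
    by (simp only: frechet_derivative_def)
qed

lemma differentiable_cong_open:
  assumes "open S" "x \<in> S" "\<And>y. y \<in> S \<Longrightarrow> f y = g y" "f differentiable (at x)"
  shows "g differentiable (at x)"
proof -
  have "(g has_derivative frechet_derivative f (at x)) (at x)"
    by (rule has_derivative_transform_within_open[OF differentiable_has_derivative[OF assms(4)] assms(1,2)])
       (rule assms(3))
  then show ?thesis
    by (rule differentiableI)
qed

lemma pd_cong_open:
  "open S \<Longrightarrow> x \<in> S \<Longrightarrow> (\<And>y. y \<in> S \<Longrightarrow> f y = g y) \<Longrightarrow> pd \<mu> f x = pd \<mu> g x"
  unfolding pd_def using frechet_derivative_cong_open[of S x f g] by simp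

lemma pd_mult:
  assumes "f differentiable (at x)" "g differentiable (at x)"
  shows "pd \<mu> (\<lambda>x. f x * g x) x = pd \<mu> f x * g x + f x * pd \<mu> g x"
  using pd_eqI[OF has_derivative_mult[OF assms[THEN differentiable_has_derivative]], of \<mu>]
  by (simp add: pd_def)

lemma pd_add:
  assumes "f differentiable (at x)" "g differentiable (at x)"
  shows "pd \<mu> (\<lambda>x. f x + g x) x = pd \<mu> f x + pd \<mu> g x"
  using pd_eqI[OF has_derivative_add[OF assms[THEN differentiable_has_derivative]], of \<mu>]
  by (simp add: pd_def)

lemma pd_diff:
  assumes "f differentiable (at x)" "g differentiable (at x)"
  shows "pd \<mu> (\<lambda>x. f x - g x) x = pd \<mu> f x - pd \<mu> g x"
  using pd_eqI[OF has_derivative_diff[OF assms[THEN differentiable_has_derivative]], of \<mu>]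
  by (simp add: pd_def)

lemma pd_uminus:
  assumes "f differentiable (at x)"
  shows "pd \<mu> (\<lambda>x. - f x) x = - pd \<mu> f x"
  using pd_eqI[OF has_derivative_minus[OF assms[THEN differentiable_has_derivative]], of \<mu>]
  by (simp add: pd_def)

lemma pd_const: "pd \<mu> (\<lambda>x. c) x = 0"
  by (simp add: pd_def frechet_derivative_const)

lemma pd_sum:
  assumes "\<And>i. i \<in> I \<Longrightarrow> f i differentiable (at x)"
  shows "pd \<mu> (\<lambda>x. \<Sum>i\<in>I. f i x) x = (\<Sum>i\<in>I. pd \<mu> (f i) x)"
  using pd_eqI[OF has_derivative_sum[OF assms[THEN differentiable_has_derivative]], where \<mu> = \<mu>]
  by (simp add: pd_def)

lemma pd_inverse:
  assumes "f differentiable (at x)" "f x \<noteq> 0"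
  shows "pd \<mu> (\<lambda>x. inverse (f x)) x = - pd \<mu> f x / (f x)\<^sup>2"
  using pd_eqI[OF Deriv.has_derivative_inverse[OF assms(2) differentiable_has_derivative[OF assms(1)]], of \<mu>]
  by (simp add: pd_def power2_eq_square divide_simps)

lemma pd_ln:
  assumes "f differentiable (at x)" "f x > 0"
  shows "pd \<mu> (\<lambda>x. ln (f x)) x = pd \<mu> f x / f x"
  using pd_eqI[OF has_derivative_ln[OF assms(2) differentiable_has_derivative[OF assms(1)]], of \<mu>]
  by (simp add: pd_def divide_inverse)

lemma has_derivative_component: "((\<lambda>x. x $ i) has_derivative (\<lambda>x. x $ i)) F"
  by (rule bounded_linear_imp_has_derivative[OF bounded_linear_vec_nth])

lemma pd_vec_nth: "pd \<mu> (\<lambda>x. x $ \<rho>) x = kron \<mu> \<rho>"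
  using pd_eqI[OF has_derivative_component, of \<mu>] by (simp add: axis_def kron_def)

lemma frechet_derivative_pd_sum:
  fixes f :: "real^'m::finite \<Rightarrow> real"
  assumes "f differentiable (at x)"
  shows "frechet_derivative f (at x) v = (\<Sum>\<mu>\<in>UNIV. v $ \<mu> * pd \<mu> f x)"
proof -
  have lin: "linear (frechet_derivative f (at x))"
    using assms by (simp add: linear_frechet_derivative)
  have "frechet_derivative f (at x) v = frechet_derivative f (at x) (\<Sum>\<mu>\<in>UNIV. v $ \<mu> *\<^sub>R axis \<mu> 1)"
    by (simp add: basis_expansion scalar_mult_eq_scaleR[symmetric])
  also have "\<dots> = (\<Sum>\<mu>\<in>UNIV. v $ \<mu> * pd \<mu> f x)"
    by (simp add: linear_sum[OF lin] linear_scale[OF lin] pd_def)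
  finally show ?thesis .
qed

text \<open>Differentiating f (t x) = t^k f x in x produces an extra factor t on the left, which
  lowers the degree by one. Iteration yields the degrees D - 1, D - 2 and D - 3 of the derivatives
  of h.\<close>

lemma pd_homogeneous:
  fixes f :: "real^'m::finite \<Rightarrow> real"
  assumes f: "\<And>x. x \<in> U \<Longrightarrow> f differentiable (at x)"
    and U: "open U" "\<And>t x. t > 0 \<Longrightarrow> x \<in> U \<Longrightarrow> t *\<^sub>R x \<in> U"
    and hom: "\<And>t x. t > 0 \<Longrightarrow> x \<in> U \<Longrightarrow> f (t *\<^sub>R x) = t powr k * f x"
    and t: "t > 0" and x: "x \<in> U"
  shows "pd \<mu> f (t *\<^sub>R x) = t powr (k - 1) * pd \<mu> f x"
proof -
  have "((\<lambda>x. f (t *\<^sub>R x)) has_derivative (\<lambda>v. frechet_derivative f (at (t *\<^sub>R x)) (t *\<^sub>R v))) (at x)"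
    by (rule has_derivative_compose[where g = f])
       (auto intro!: derivative_eq_intros differentiable_has_derivative f U t x)
  from pd_eqI[OF this, of \<mu>] have "pd \<mu> (\<lambda>x. f (t *\<^sub>R x)) x = t * pd \<mu> f (t *\<^sub>R x)"
    by (simp add: pd_def linear_scale[OF linear_frechet_derivative[OF f[OF U(2)[OF t x]]]])
  moreover have "pd \<mu> (\<lambda>x. f (t *\<^sub>R x)) x = pd \<mu> (\<lambda>x. t powr k * f x) x"
    using U x hom t by (intro pd_cong_open[where S = U]) auto
  moreover have "\<dots> = t powr k * pd \<mu> f x"
    by (subst pd_mult) (auto simp: pd_const f x)
  ultimately have "t * pd \<mu> f (t *\<^sub>R x) = t * (t powr (k - 1) * pd \<mu> f x)"
    using t by (simp add: powr_diff)
  then show ?thesis using t by simp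
qed

text \<open>Both sides are the derivative at t = 1 of f along the ray through x.\<close>

lemma euler_homogeneous:
  fixes f :: "real^'m::finite \<Rightarrow> real"
  assumes f: "f differentiable (at x)" and x: "x \<in> U"
    and hom: "\<And>t x. t > 0 \<Longrightarrow> x \<in> U \<Longrightarrow> f (t *\<^sub>R x) = t powr k * f x"
  shows "(\<Sum>\<mu>\<in>UNIV. x $ \<mu> * pd \<mu> f x) = k * f x"
proof -
  have 1: "((\<lambda>t. f (0 + t *\<^sub>R x)) has_real_derivative frechet_derivative f (at (0 + 1 *\<^sub>R x)) x) (at 1)"
    using f by (intro has_real_derivative_along_line) simp
  have "((\<lambda>t. t powr k * f x) has_real_derivative k * f x) (at 1)"
    by (auto intro!: derivative_eq_intros)
  then have "((\<lambda>t. f (0 + t *\<^sub>R x)) has_real_derivative k * f x) (at 1)"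
    by (rule has_field_derivative_transform_within_open[where S = "{0<..}"]) (auto simp: hom x)
  from DERIV_unique[OF 1 this] have "frechet_derivative f (at x) x = k * f x"
    by simp
  then show ?thesis
    by (simp add: frechet_derivative_pd_sum[OF f])
qed

section \<open>Homogeneous functions and the potential\<close>

lemma sum_kron [simp]:
  fixes f :: "'m::finite \<Rightarrow> real"
  shows "(\<Sum>\<rho>\<in>UNIV. f \<rho> * kron \<rho> \<mu>) = f \<mu>" "(\<Sum>\<rho>\<in>UNIV. f \<rho> * kron \<mu> \<rho>) = f \<mu>"
    "(\<Sum>\<rho>\<in>UNIV. kron \<rho> \<mu> * f \<rho>) = f \<mu>" "(\<Sum>\<rho>\<in>UNIV. kron \<mu> \<rho> * f \<rho>) = f \<mu>"
  by (simp_all add: kron_def if_distrib[where f = "\<lambda>y. _ * y"] if_distrib[where f = "\<lambda>y. y * _"]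
      cong: if_cong)

lemma kron_commute: "kron \<mu> \<nu> = kron \<nu> \<mu>"
  by (simp add: kron_def eq_commute)

lemma kron_same [simp]: "kron \<mu> \<mu> = 1"
  by (simp add: kron_def)

text \<open>The components \<open>K\<^bsub>\<mu>\<nu>\<^esub>\<close> and \<open>K\<^bsub>\<tau>\<mu>\<sigma>\<^esub>\<close> of \<open>K = - ln h\<close>, and \<open>P\<^sup>\<rho>\<^bsub>\<mu>\<sigma>\<^esub> = K\<^sup>\<rho>\<^sup>\<tau> K\<^bsub>\<tau>\<mu>\<sigma>\<^esub>\<close> in closed form.\<close>

definition K2 :: "(real^'m::finite \<Rightarrow> real) \<Rightarrow> real^'m \<Rightarrow> 'm \<Rightarrow> 'm \<Rightarrow> real" where
  "K2 h x \<mu> \<nu> = - h2 h x \<mu> \<nu> / h x + h1 h x \<mu> * h1 h x \<nu> / (h x)\<^sup>2"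

definition K3 :: "(real^'m::finite \<Rightarrow> real) \<Rightarrow> real^'m \<Rightarrow> 'm \<Rightarrow> 'm \<Rightarrow> 'm \<Rightarrow> real" where
  "K3 h x \<tau> \<mu> \<sigma> = - h3 h x \<tau> \<mu> \<sigma> / h x
     + (h2 h x \<tau> \<mu> * h1 h x \<sigma> + h2 h x \<tau> \<sigma> * h1 h x \<mu> + h2 h x \<mu> \<sigma> * h1 h x \<tau>) / (h x)\<^sup>2
     - 2 * h1 h x \<tau> * h1 h x \<mu> * h1 h x \<sigma> / (h x)^3"

definition christoffel :: "(real^'m::finite \<Rightarrow> real) \<Rightarrow> real \<Rightarrow> real^'m \<Rightarrow> 'm \<Rightarrow> 'm \<Rightarrow> 'm \<Rightarrow> real" where
  "christoffel h D x \<rho> \<mu> \<sigma> = - h_udd h x \<rho> \<mu> \<sigma>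
     - (kron \<rho> \<mu> * h1 h x \<sigma> + kron \<rho> \<sigma> * h1 h x \<mu>) / h x
     + x $ \<rho> * h2 h x \<mu> \<sigma> / ((D - 1) * h x)"

locale r_map_domain =
  fixes U :: "(real^'m::finite) set" and h :: "real^'m \<Rightarrow> real" and D :: real
  assumes open_U: "open U"
    and cone: "t > 0 \<Longrightarrow> x \<in> U \<Longrightarrow> t *\<^sub>R x \<in> U"
    and pos: "x \<in> U \<Longrightarrow> h x > 0"
    and smooth: "smooth_on U h"
    and D: "D > 0" "D \<noteq> 1"
    and hom: "t > 0 \<Longrightarrow> x \<in> U \<Longrightarrow> h (t *\<^sub>R x) = t powr D * h x"
    and riem: "minus_hessian_riemannian_on_level U h"
begin

section \<open>Symmetries, homogeneity and Euler relations of the derivatives of h\<close>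

lemma nonzero: "x \<in> U \<Longrightarrow> h x \<noteq> 0" "D - 1 \<noteq> 0"
  using pos[of x] D by auto

lemma smooth_derivs:
  "smooth_on U (\<lambda>x. h1 h x \<mu>)" "smooth_on U (\<lambda>x. h2 h x \<mu> \<nu>)"
  "smooth_on U (\<lambda>x. h3 h x \<mu> \<nu> \<rho>)" "smooth_on U (\<lambda>x. h4 h x \<mu> \<nu> \<rho> \<sigma>)"
  unfolding h1_def h2_def h3_def h4_def by (intro smooth_on_pd smooth)+

lemma differentiable_derivs:
  assumes "x \<in> U"
  shows "h differentiable (at x)" "(\<lambda>x. h1 h x \<mu>) differentiable (at x)"
    "(\<lambda>x. h2 h x \<mu> \<nu>) differentiable (at x)" "(\<lambda>x. h3 h x \<mu> \<nu> \<rho>) differentiable (at x)"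
  using assms smooth smooth_derivs smooth_on_differentiable by blast+

lemma pd_derivs:
  "pd \<nu> h x = h1 h x \<nu>" "pd \<nu> (\<lambda>x. h1 h x \<mu>) x = h2 h x \<nu> \<mu>"
  "pd \<nu> (\<lambda>x. h2 h x \<mu> \<rho>) x = h3 h x \<nu> \<mu> \<rho>" "pd \<nu> (\<lambda>x. h3 h x \<mu> \<rho> \<sigma>) x = h4 h x \<nu> \<mu> \<rho> \<sigma>"
  by (simp_all add: h1_def h2_def h3_def h4_def)

lemma h2_commute: "x \<in> U \<Longrightarrow> h2 h x \<mu> \<nu> = h2 h x \<nu> \<mu>"
  unfolding h2_def by (rule pd_commute[OF open_U smooth])

lemma h3_swap12: "x \<in> U \<Longrightarrow> h3 h x \<mu> \<nu> \<rho> = h3 h x \<nu> \<mu> \<rho>"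
  unfolding h3_def by (intro pd_commute[OF open_U] smooth_on_pd smooth)

text \<open>Exchanging inner indices means differentiating a symmetry that holds on all of U,
  whereas the outermost exchange is Schwarz's theorem for a derivative of h. Adjacent exchanges
  generate every reordering used later.\<close>

lemma h3_swap23: "x \<in> U \<Longrightarrow> h3 h x \<mu> \<nu> \<rho> = h3 h x \<mu> \<rho> \<nu>"
  unfolding h3_def by (intro pd_cong_open[OF open_U] pd_commute[OF open_U smooth])

lemma h4_swap12: "x \<in> U \<Longrightarrow> h4 h x \<mu> \<nu> \<rho> \<sigma> = h4 h x \<nu> \<mu> \<rho> \<sigma>"
  unfolding h4_def by (intro pd_commute[OF open_U] smooth_on_pd smooth)

lemma h4_swap23: "x \<in> U \<Longrightarrow> h4 h x \<mu> \<nu> \<rho> \<sigma> = h4 h x \<mu> \<rho> \<nu> \<sigma>"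
  unfolding h4_def by (intro pd_cong_open[OF open_U] pd_commute[OF open_U] smooth_on_pd smooth)

lemma h4_swap34: "x \<in> U \<Longrightarrow> h4 h x \<mu> \<nu> \<rho> \<sigma> = h4 h x \<mu> \<nu> \<sigma> \<rho>"
  unfolding h4_def by (intro pd_cong_open[OF open_U] pd_commute[OF open_U smooth])

lemma h1_homogeneous:
  "t > 0 \<Longrightarrow> x \<in> U \<Longrightarrow> h1 h (t *\<^sub>R x) \<mu> = t powr (D - 1) * h1 h x \<mu>"
  unfolding h1_def by (rule pd_homogeneous[OF differentiable_derivs(1) open_U cone hom])

lemma h2_homogeneous:
  "t > 0 \<Longrightarrow> x \<in> U \<Longrightarrow> h2 h (t *\<^sub>R x) \<mu> \<nu> = t powr (D - 2) * h2 h x \<mu> \<nu>"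
  using pd_homogeneous[OF differentiable_derivs(2) open_U cone h1_homogeneous, of t x \<mu> \<nu>]
  by (simp add: pd_derivs)

lemma h3_homogeneous:
  "t > 0 \<Longrightarrow> x \<in> U \<Longrightarrow> h3 h (t *\<^sub>R x) \<mu> \<nu> \<rho> = t powr (D - 3) * h3 h x \<mu> \<nu> \<rho>"
  using pd_homogeneous[OF differentiable_derivs(3) open_U cone h2_homogeneous, of t x \<mu> \<nu> \<rho>]
  by (simp add: pd_derivs)

lemma euler_derivs:
  assumes x: "x \<in> U"
  shows "(\<Sum>\<alpha>\<in>UNIV. x $ \<alpha> * h1 h x \<alpha>) = D * h x"
    "(\<Sum>\<alpha>\<in>UNIV. x $ \<alpha> * h2 h x \<alpha> \<mu>) = (D - 1) * h1 h x \<mu>"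
    "(\<Sum>\<alpha>\<in>UNIV. x $ \<alpha> * h3 h x \<alpha> \<mu> \<nu>) = (D - 2) * h2 h x \<mu> \<nu>"
    "(\<Sum>\<alpha>\<in>UNIV. x $ \<alpha> * h4 h x \<alpha> \<mu> \<nu> \<rho>) = (D - 3) * h3 h x \<mu> \<nu> \<rho>"
  using euler_homogeneous[OF differentiable_derivs(1)[OF x] x hom]
    euler_homogeneous[OF differentiable_derivs(2)[OF x] x h1_homogeneous]
    euler_homogeneous[OF differentiable_derivs(3)[OF x] x h2_homogeneous]
    euler_homogeneous[OF differentiable_derivs(4)[OF x] x h3_homogeneous]
  by (simp_all add: pd_derivs)

text \<open>The ray through x meets the level set h = 1. Along it \<open>h1\<close> and
  \<open>h2\<close> change only by positive factors, so the kernel of dh stays the same and the sign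
  of the Hessian on it carries over.\<close>

lemma hessian_negative_on_kernel:
  assumes x: "x \<in> U" and v: "(\<Sum>\<mu>\<in>UNIV. v $ \<mu> * h1 h x \<mu>) = 0" "v \<noteq> 0"
  shows "(\<Sum>\<mu>\<in>UNIV. \<Sum>\<nu>\<in>UNIV. h2 h x \<mu> \<nu> * v $ \<mu> * v $ \<nu>) < 0"
proof -
  \<comment> \<open>The solution of t^D h x = 1.\<close>
  define t where "t = h x powr (- 1 / D)"
  have t: "t > 0" using pos[OF x] by (simp add: t_def)
  have tx: "t *\<^sub>R x \<in> U" using cone t x by blast
  have "t powr D = inverse (h x)"
    using pos[OF x] D(1) by (simp add: t_def powr_powr powr_neg_one inverse_eq_divide)
  then have "h (t *\<^sub>R x) = 1"
    using hom[OF t x] nonzero(1)[OF x] by simp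
  moreover have "frechet_derivative h (at (t *\<^sub>R x)) v = 0"
  proof -
    have "frechet_derivative h (at (t *\<^sub>R x)) v = t powr (D - 1) * (\<Sum>\<mu>\<in>UNIV. v $ \<mu> * h1 h x \<mu>)"
      by (simp add: frechet_derivative_pd_sum[OF differentiable_derivs(1)[OF tx]] pd_derivs
          h1_homogeneous[OF t x] sum_distrib_left ac_simps)
    then show ?thesis by (simp add: v)
  qed
  ultimately have "- (\<Sum>\<mu>\<in>UNIV. \<Sum>\<nu>\<in>UNIV. h2 h (t *\<^sub>R x) \<mu> \<nu> * v $ \<mu> * v $ \<nu>) > 0"
    using riem tx v(2) unfolding minus_hessian_riemannian_on_level_def by blast
  moreover have "(\<Sum>\<mu>\<in>UNIV. \<Sum>\<nu>\<in>UNIV. h2 h (t *\<^sub>R x) \<mu> \<nu> * v $ \<mu> * v $ \<nu>)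
      = t powr (D - 2) * (\<Sum>\<mu>\<in>UNIV. \<Sum>\<nu>\<in>UNIV. h2 h x \<mu> \<nu> * v $ \<mu> * v $ \<nu>)"
    by (simp add: h2_homogeneous[OF t x] sum_distrib_left ac_simps)
  ultimately show ?thesis
    using t by (simp add: mult_less_0_iff)
qed

text \<open>Pairing the Hessian applied to v with x gives (D - 1) dh(v) by Euler, so a null vector
  lies in the kernel of dh, where the Hessian is definite. Definiteness on the whole space cannot be
  expected: for D > 1 the value at (x, x), D (D - 1) h, is positive.\<close>

lemma h2_nondegenerate:
  assumes x: "x \<in> U" and v: "\<And>\<mu>. (\<Sum>\<nu>\<in>UNIV. h2 h x \<mu> \<nu> * v $ \<nu>) = 0"
  shows "v = 0"
proof (rule ccontr)
  assume "v \<noteq> 0"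
  have "(D - 1) * (\<Sum>\<nu>\<in>UNIV. v $ \<nu> * h1 h x \<nu>) = (\<Sum>\<nu>\<in>UNIV. v $ \<nu> * (\<Sum>\<mu>\<in>UNIV. x $ \<mu> * h2 h x \<mu> \<nu>))"
    by (simp add: euler_derivs[OF x] sum_distrib_left ac_simps)
  also have "\<dots> = (\<Sum>\<mu>\<in>UNIV. x $ \<mu> * (\<Sum>\<nu>\<in>UNIV. h2 h x \<mu> \<nu> * v $ \<nu>))"
    unfolding sum_distrib_left by (subst sum.swap) (simp add: ac_simps)
  finally have "(\<Sum>\<nu>\<in>UNIV. v $ \<nu> * h1 h x \<nu>) = 0"
    using nonzero by (simp add: v)
  from hessian_negative_on_kernel[OF x this \<open>v \<noteq> 0\<close>]
  have "(\<Sum>\<mu>\<in>UNIV. v $ \<mu> * (\<Sum>\<nu>\<in>UNIV. h2 h x \<mu> \<nu> * v $ \<nu>)) < 0"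
    by (simp add: sum_distrib_left ac_simps)
  then show False by (simp add: v)
qed

lemma hess_inv_inverse:
  assumes x: "x \<in> U"
  shows "(\<Sum>\<tau>\<in>UNIV. hess_inv h x \<rho> \<tau> * h2 h x \<tau> \<sigma>) = kron \<rho> \<sigma>"
    and "(\<Sum>\<tau>\<in>UNIV. h2 h x \<rho> \<tau> * hess_inv h x \<tau> \<sigma>) = kron \<rho> \<sigma>"
proof -
  define A where "A = (\<chi> \<alpha> \<beta>. h2 h x \<alpha> \<beta>)"
  have "\<exists>B. B ** A = mat 1"
    unfolding matrix_left_invertible_ker
    using h2_nondegenerate[OF x] by (simp add: A_def matrix_vector_mult_def vec_eq_iff)
  then have "invertible A"
    by (simp add: invertible_left_inverse)
  then have "A ** matrix_inv A = mat 1 \<and> matrix_inv A ** A = mat 1"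
    unfolding invertible_def matrix_inv_def by (rule someI_ex)
  then have "(matrix_inv A ** A) $ \<rho> $ \<sigma> = kron \<rho> \<sigma>" "(A ** matrix_inv A) $ \<rho> $ \<sigma> = kron \<rho> \<sigma>"
    by (auto simp: mat_def kron_def)
  then show "(\<Sum>\<tau>\<in>UNIV. hess_inv h x \<rho> \<tau> * h2 h x \<tau> \<sigma>) = kron \<rho> \<sigma>"
    and "(\<Sum>\<tau>\<in>UNIV. h2 h x \<rho> \<tau> * hess_inv h x \<tau> \<sigma>) = kron \<rho> \<sigma>"
    by (simp_all add: matrix_matrix_mult_def A_def hess_inv_def)
qed

text \<open>Formulas involving the inverse Hessian are obtained by checking a candidate against the
  linear system with matrix \<open>h2\<close>.\<close>

lemma hess_inv_solve:
  assumes x: "x \<in> U" and eq: "\<And>\<tau>. (\<Sum>\<rho>\<in>UNIV. h2 h x \<tau> \<rho> * a \<rho>) = b \<tau>"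
  shows "a \<rho> = (\<Sum>\<tau>\<in>UNIV. hess_inv h x \<rho> \<tau> * b \<tau>)"
proof -
  have "(\<Sum>\<tau>\<in>UNIV. hess_inv h x \<rho> \<tau> * b \<tau>)
      = (\<Sum>\<sigma>\<in>UNIV. (\<Sum>\<tau>\<in>UNIV. hess_inv h x \<rho> \<tau> * h2 h x \<tau> \<sigma>) * a \<sigma>)"
    unfolding eq[symmetric] sum_distrib_left sum_distrib_right by (subst sum.swap) (simp add: ac_simps)
  then show ?thesis by (simp add: hess_inv_inverse[OF x])
qed

lemma hess_inv_commute:
  assumes x: "x \<in> U"
  shows "hess_inv h x \<rho> \<sigma> = hess_inv h x \<sigma> \<rho>"
proof -
  have "(\<Sum>\<rho>\<in>UNIV. h2 h x \<tau> \<rho> * hess_inv h x \<sigma> \<rho>) = kron \<tau> \<sigma>" for \<tau>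
    using hess_inv_inverse(1)[OF x, of \<sigma> \<tau>]
    by (simp add: h2_commute[OF x, of \<tau>] mult.commute kron_commute)
  from hess_inv_solve[OF x this, of \<rho>] show ?thesis
    by simp
qed

text \<open>Euler's relation for \<open>h1\<close>, solved for x; this is the source of every 1 / (D
  - 1) in the curvature.\<close>

lemma hess_inv_h1:
  assumes x: "x \<in> U"
  shows "(\<Sum>\<tau>\<in>UNIV. hess_inv h x \<rho> \<tau> * h1 h x \<tau>) = x $ \<rho> / (D - 1)"
proof -
  have "(\<Sum>\<rho>\<in>UNIV. h2 h x \<tau> \<rho> * (x $ \<rho> / (D - 1))) = h1 h x \<tau>" for \<tau>
    using euler_derivs(2)[OF x, of \<tau>] nonzero
    by (simp add: h2_commute[OF x, of \<tau>] sum_divide_distrib[symmetric] ac_simps)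
  from hess_inv_solve[OF x this] show ?thesis by simp
qed

section \<open>The closed form of the Christoffel coefficients\<close>

lemma h2_h_udd:
  assumes x: "x \<in> U"
  shows "(\<Sum>\<rho>\<in>UNIV. h2 h x \<tau> \<rho> * h_udd h x \<rho> \<sigma> \<mu>) = - h3 h x \<tau> \<sigma> \<mu>"
proof -
  have "(\<Sum>\<rho>\<in>UNIV. h2 h x \<tau> \<rho> * h_udd h x \<rho> \<sigma> \<mu>)
    = - (\<Sum>\<kappa>\<in>UNIV. (\<Sum>\<rho>\<in>UNIV. h2 h x \<tau> \<rho> * hess_inv h x \<rho> \<kappa>) * h3 h x \<kappa> \<sigma> \<mu>)"
    unfolding h_udd_def sum_distrib_left sum_distrib_right mult_minus_right sum_negf
    by (subst sum.swap) (simp add: ac_simps)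
  then show ?thesis by (simp add: hess_inv_inverse[OF x])
qed

text \<open>The inverse Hessian inside \<open>h_udd\<close> turns dh into x / (D - 1), and Euler's
  relation for \<open>h2\<close> evaluates the contraction of x with \<open>h3\<close>.\<close>

lemma h1_h_udd:
  assumes x: "x \<in> U"
  shows "(\<Sum>\<rho>\<in>UNIV. h1 h x \<rho> * h_udd h x \<rho> \<sigma> \<mu>) = - ((D - 2) / (D - 1) * h2 h x \<sigma> \<mu>)"
proof -
  have "(\<Sum>\<rho>\<in>UNIV. h1 h x \<rho> * h_udd h x \<rho> \<sigma> \<mu>)
    = - (\<Sum>\<kappa>\<in>UNIV. (\<Sum>\<rho>\<in>UNIV. hess_inv h x \<kappa> \<rho> * h1 h x \<rho>) * h3 h x \<kappa> \<sigma> \<mu>)"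
    unfolding h_udd_def sum_distrib_left sum_distrib_right mult_minus_right sum_negf
    by (subst sum.swap) (simp add: ac_simps hess_inv_commute[OF x])
  also have "\<dots> = - (\<Sum>\<kappa>\<in>UNIV. x $ \<kappa> * h3 h x \<kappa> \<sigma> \<mu>) / (D - 1)"
    by (simp add: hess_inv_h1[OF x] sum_divide_distrib)
  finally show ?thesis
    by (simp add: euler_derivs[OF x])
qed

lemma h_udd_commute: "x \<in> U \<Longrightarrow> h_udd h x \<rho> \<sigma> \<mu> = h_udd h x \<rho> \<mu> \<sigma>"
  by (simp add: h_udd_def h3_swap23[of x _ \<sigma> \<mu>])

text \<open>Stated for an arbitrary covector c because \<open>K2\<close> is built from two of them:
  a row of the Hessian and dh.\<close>

lemma sum_christoffel:
  "(\<Sum>\<rho>\<in>UNIV. c \<rho> * christoffel h D x \<rho> \<mu> \<sigma>) = - (\<Sum>\<rho>\<in>UNIV. c \<rho> * h_udd h x \<rho> \<mu> \<sigma>)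
     - (c \<mu> * h1 h x \<sigma> + c \<sigma> * h1 h x \<mu>) / h x
     + (\<Sum>\<rho>\<in>UNIV. x $ \<rho> * c \<rho>) * h2 h x \<mu> \<sigma> / ((D - 1) * h x)"
proof -
  have "c \<rho> * christoffel h D x \<rho> \<mu> \<sigma> = - (c \<rho> * h_udd h x \<rho> \<mu> \<sigma>)
     - ((c \<rho> * kron \<rho> \<mu>) * (h1 h x \<sigma> / h x) + (c \<rho> * kron \<rho> \<sigma>) * (h1 h x \<mu> / h x))
     + (x $ \<rho> * c \<rho>) * (h2 h x \<mu> \<sigma> / ((D - 1) * h x))" for \<rho>
    by (simp add: christoffel_def algebra_simps add_divide_distrib)
  then show ?thesis
    by (simp only: sum.distrib sum_subtractf sum_negf sum_distrib_right[symmetric] sum_kron)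
       (simp add: add_divide_distrib)
qed

text \<open>Lowering the upper index confirms that \<open>christoffel\<close> is \<open>K3\<close>
  with its first index raised by the inverse of \<open>K2\<close>.\<close>

lemma K2_christoffel:
  assumes x: "x \<in> U"
  shows "(\<Sum>\<rho>\<in>UNIV. K2 h x \<tau> \<rho> * christoffel h D x \<rho> \<mu> \<sigma>) = K3 h x \<tau> \<mu> \<sigma>"
proof -
  have 1: "(\<Sum>\<rho>\<in>UNIV. K2 h x \<tau> \<rho> * christoffel h D x \<rho> \<mu> \<sigma>)
     = - (\<Sum>\<rho>\<in>UNIV. h2 h x \<tau> \<rho> * christoffel h D x \<rho> \<mu> \<sigma>) / h x
       + h1 h x \<tau> * (\<Sum>\<rho>\<in>UNIV. h1 h x \<rho> * christoffel h D x \<rho> \<mu> \<sigma>) / (h x)\<^sup>2"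
    by (simp add: K2_def algebra_simps sum.distrib sum_subtractf sum_negf sum_distrib_left sum_divide_distrib)
  have 2: "(\<Sum>\<rho>\<in>UNIV. h2 h x \<tau> \<rho> * christoffel h D x \<rho> \<mu> \<sigma>)
     = h3 h x \<tau> \<mu> \<sigma> - (h2 h x \<tau> \<mu> * h1 h x \<sigma> + h2 h x \<tau> \<sigma> * h1 h x \<mu>) / h x
       + h1 h x \<tau> * h2 h x \<mu> \<sigma> / h x"
  proof -
    have "(\<Sum>\<rho>\<in>UNIV. x $ \<rho> * h2 h x \<tau> \<rho>) = (D - 1) * h1 h x \<tau>"
      using euler_derivs(2)[OF x, of \<tau>] by (simp add: h2_commute[OF x, of \<tau>])
    then show ?thesis
      using nonzero(2) by (simp add: sum_christoffel h2_h_udd[OF x])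
  qed
  \<comment> \<open>The first summand comes from contracting dh with \<open>h_udd\<close>, the
    second from contracting it with x. Their sum being free of D is what makes the result agree with
    \<open>K3\<close>.\<close>
  have "(D - 2) / (D - 1) + D / (D - 1) = 2"
    using nonzero(2) by (simp add: divide_simps)
  then have D_eq: "(D - 2) / (D - 1) * a + D / (D - 1) * a = 2 * a" for a
    by (simp only: distrib_right[symmetric])
  have 3: "(\<Sum>\<rho>\<in>UNIV. h1 h x \<rho> * christoffel h D x \<rho> \<mu> \<sigma>)
     = 2 * h2 h x \<mu> \<sigma> - 2 * h1 h x \<mu> * h1 h x \<sigma> / h x"
    unfolding sum_christoffel h1_h_udd[OF x] euler_derivs[OF x] D_eq[symmetric]
    using nonzero(1)[OF x] nonzero(2) by (simp add: divide_simps) (simp add: algebra_simps)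
  show ?thesis
    unfolding 1 2 3
    using nonzero(1)[OF x] by (simp add: K3_def field_simps power2_eq_square power3_eq_cube)
qed

end

text \<open>The Sherman-Morrison inverse of \<open>- h2 / h\<close> plus dh dh / h^2. Its
  denominator is 1 - D / (D - 1) = - 1 / (D - 1), and both factors of the correction are multiples
  of x by \<open>hess_inv_h1\<close>.\<close>

definition K2_inv :: "(real^'m::finite \<Rightarrow> real) \<Rightarrow> real \<Rightarrow> real^'m \<Rightarrow> 'm \<Rightarrow> 'm \<Rightarrow> real" where
  "K2_inv h D x \<mu> \<nu> = - h x * hess_inv h x \<mu> \<nu> + x $ \<mu> * x $ \<nu> / (D - 1)"

context r_map_domain
begin

text \<open>Quotients are written with \<open>inverse\<close> so that the product rule and
  \<open>pd_inverse\<close> apply.\<close>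

lemma K2_eq: "K2 h x \<mu> \<nu> = - (h2 h x \<mu> \<nu> * inverse (h x)) + h1 h x \<mu> * h1 h x \<nu> * (inverse (h x) * inverse (h x))"
  by (simp add: K2_def divide_inverse power2_eq_square)

lemma differentiable_inverse_h: "x \<in> U \<Longrightarrow> (\<lambda>x. inverse (h x)) differentiable (at x)"
  by (intro differentiable_inverse differentiable_derivs nonzero)

lemma differentiable_K2: "x \<in> U \<Longrightarrow> (\<lambda>x. K2 h x \<mu> \<nu>) differentiable (at x)"
  unfolding K2_eq
  by (intro differentiable_add differentiable_minus differentiable_mult differentiable_derivs
      differentiable_inverse_h)

lemma pd_K2:
  assumes x: "x \<in> U"
  shows "pd \<tau> (\<lambda>x. K2 h x \<mu> \<nu>) x = K3 h x \<tau> \<mu> \<nu>"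
proof -
  note d = differentiable_derivs[OF x] differentiable_inverse_h[OF x]
  have pd_eq: "pd \<tau> (\<lambda>x. K2 h x \<mu> \<nu>) x
     = - (h3 h x \<tau> \<mu> \<nu> * inverse (h x) + h2 h x \<mu> \<nu> * (- h1 h x \<tau> / (h x)\<^sup>2))
       + ((h2 h x \<tau> \<mu> * h1 h x \<nu> + h1 h x \<mu> * h2 h x \<tau> \<nu>) * (inverse (h x) * inverse (h x))
       + h1 h x \<mu> * h1 h x \<nu> * ((- h1 h x \<tau> / (h x)\<^sup>2) * inverse (h x) + inverse (h x) * (- h1 h x \<tau> / (h x)\<^sup>2)))"
    unfolding K2_eq
    by (simp only: pd_add pd_uminus pd_mult pd_inverse pd_derivs d differentiable_mult
        differentiable_minus nonzero(1)[OF x] nonzero(2) not_False_eq_True simp_thms)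
  show ?thesis
    unfolding pd_eq using nonzero(1)[OF x] by (simp add: K3_def field_simps power2_eq_square power3_eq_cube)
qed

lemma K2_commute: "x \<in> U \<Longrightarrow> K2 h x \<mu> \<nu> = K2 h x \<nu> \<mu>"
  by (simp add: K2_def h2_commute[of x \<mu>] mult.commute)

lemma K3_swap12: "x \<in> U \<Longrightarrow> K3 h x \<mu> \<nu> \<rho> = K3 h x \<nu> \<mu> \<rho>"
  by (simp add: K3_def h3_swap12[of x \<mu>] h2_commute[of x \<mu> \<nu>] algebra_simps)

lemma K3_swap23: "x \<in> U \<Longrightarrow> K3 h x \<mu> \<nu> \<rho> = K3 h x \<mu> \<rho> \<nu>"
  by (simp add: K3_def h3_swap23[of x \<mu> \<nu>] h2_commute[of x \<rho> \<nu>] algebra_simps)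

lemma sum_K2_inv:
  "(\<Sum>\<tau>\<in>UNIV. K2_inv h D x \<rho> \<tau> * c \<tau>) = - h x * (\<Sum>\<tau>\<in>UNIV. hess_inv h x \<rho> \<tau> * c \<tau>)
     + x $ \<rho> / (D - 1) * (\<Sum>\<tau>\<in>UNIV. x $ \<tau> * c \<tau>)"
  by (simp add: K2_inv_def algebra_simps sum.distrib sum_subtractf sum_negf sum_distrib_left sum_divide_distrib)

lemma K2_inv_K2:
  assumes x: "x \<in> U"
  shows "(\<Sum>\<tau>\<in>UNIV. K2_inv h D x \<rho> \<tau> * K2 h x \<tau> \<sigma>) = kron \<rho> \<sigma>"
proof -
  have K2_sum: "(\<Sum>\<tau>\<in>UNIV. c \<tau> * K2 h x \<tau> \<sigma>) = - (\<Sum>\<tau>\<in>UNIV. c \<tau> * h2 h x \<tau> \<sigma>) / h x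
      + (\<Sum>\<tau>\<in>UNIV. c \<tau> * h1 h x \<tau>) * h1 h x \<sigma> / (h x)\<^sup>2" for c
    by (simp add: K2_def algebra_simps sum.distrib sum_subtractf sum_negf sum_distrib_left sum_divide_distrib)
  \<comment> \<open>An atom in place of D - 1 lets the denominators be cleared by
    simplification.\<close>
  obtain E where E: "E \<noteq> 0" "D = E + 1"
    using nonzero(2) by (metis diff_add_cancel)
  show ?thesis
    unfolding sum_K2_inv K2_sum hess_inv_inverse[OF x] hess_inv_h1[OF x] euler_derivs[OF x]
    using nonzero(1)[OF x] E(1) by (simp add: E(2) field_simps power2_eq_square)
qed

lemma K2_nondegenerate:
  assumes x: "x \<in> U" and a: "\<And>\<tau>. (\<Sum>\<sigma>\<in>UNIV. K2 h x \<tau> \<sigma> * a \<sigma>) = 0"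
  shows "a \<rho> = 0"
proof -
  have "a \<rho> = (\<Sum>\<sigma>\<in>UNIV. (\<Sum>\<tau>\<in>UNIV. K2_inv h D x \<rho> \<tau> * K2 h x \<tau> \<sigma>) * a \<sigma>)"
    by (simp add: K2_inv_K2[OF x])
  also have "\<dots> = (\<Sum>\<tau>\<in>UNIV. K2_inv h D x \<rho> \<tau> * (\<Sum>\<sigma>\<in>UNIV. K2 h x \<tau> \<sigma> * a \<sigma>))"
    unfolding sum_distrib_left sum_distrib_right by (subst sum.swap) (simp add: ac_simps)
  finally show ?thesis by (simp add: a)
qed

section \<open>Differentiating the Christoffel coefficients\<close>

lemma christoffel_eq: "christoffel h D x \<rho> \<mu> \<sigma> = - h_udd h x \<rho> \<mu> \<sigma>
     - (kron \<rho> \<mu> * h1 h x \<sigma> + kron \<rho> \<sigma> * h1 h x \<mu>) * inverse (h x)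
     + x $ \<rho> * h2 h x \<mu> \<sigma> * inverse (h x) * inverse (D - 1)"
  by (simp add: christoffel_def divide_inverse)

text \<open>Differentiating \<open>h\<^bsub>\<tau>\<rho>\<^esub> h\<^sup>\<rho>\<^bsub>\<mu>\<sigma>\<^esub> = - h\<^bsub>\<tau>\<mu>\<sigma>\<^esub>\<close> avoids the derivative of the inverse Hessian.\<close>

lemma pd_h_udd:
  assumes x: "x \<in> U" and diff: "\<And>\<rho>. (\<lambda>x. h_udd h x \<rho> \<mu> \<sigma>) differentiable (at x)"
  shows "pd \<nu> (\<lambda>x. h_udd h x \<rho> \<mu> \<sigma>) x
    = h_uddd h x \<rho> \<nu> \<mu> \<sigma> + (\<Sum>\<beta>\<in>UNIV. h_udd h x \<rho> \<nu> \<beta> * h_udd h x \<beta> \<mu> \<sigma>)"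
proof -
  have "(\<Sum>\<rho>\<in>UNIV. h2 h x \<tau> \<rho> * pd \<nu> (\<lambda>x. h_udd h x \<rho> \<mu> \<sigma>) x)
     = - h4 h x \<nu> \<tau> \<mu> \<sigma> - (\<Sum>\<rho>\<in>UNIV. h3 h x \<nu> \<tau> \<rho> * h_udd h x \<rho> \<mu> \<sigma>)" for \<tau>
  proof -
    note d = differentiable_derivs[OF x] diff
    have "pd \<nu> (\<lambda>x. \<Sum>\<rho>\<in>UNIV. h2 h x \<tau> \<rho> * h_udd h x \<rho> \<mu> \<sigma>) x
      = pd \<nu> (\<lambda>x. - h3 h x \<tau> \<mu> \<sigma>) x"
      by (rule pd_cong_open[OF open_U x]) (rule h2_h_udd)
    moreover have "pd \<nu> (\<lambda>x. \<Sum>\<rho>\<in>UNIV. h2 h x \<tau> \<rho> * h_udd h x \<rho> \<mu> \<sigma>) x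
      = (\<Sum>\<rho>\<in>UNIV. h3 h x \<nu> \<tau> \<rho> * h_udd h x \<rho> \<mu> \<sigma> + h2 h x \<tau> \<rho> * pd \<nu> (\<lambda>x. h_udd h x \<rho> \<mu> \<sigma>) x)"
      by (simp add: pd_sum pd_mult d pd_derivs)
    ultimately show ?thesis
      by (simp add: sum.distrib pd_uminus d pd_derivs)
  qed
  from hess_inv_solve[OF x this, of \<rho>]
  have "pd \<nu> (\<lambda>x. h_udd h x \<rho> \<mu> \<sigma>) x = (\<Sum>\<tau>\<in>UNIV. hess_inv h x \<rho> \<tau> *
      (- h4 h x \<nu> \<tau> \<mu> \<sigma> - (\<Sum>\<beta>\<in>UNIV. h3 h x \<nu> \<tau> \<beta> * h_udd h x \<beta> \<mu> \<sigma>)))" .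
  also have "\<dots> = h_uddd h x \<rho> \<nu> \<mu> \<sigma>
     - (\<Sum>\<tau>\<in>UNIV. \<Sum>\<beta>\<in>UNIV. hess_inv h x \<rho> \<tau> * h3 h x \<tau> \<nu> \<beta> * h_udd h x \<beta> \<mu> \<sigma>)"
    by (simp add: h_uddd_def h4_swap12[OF x, of \<nu>] h3_swap12[OF x, of \<nu>] right_diff_distrib
        sum_subtractf sum_negf sum_distrib_left mult.assoc)
  also have "(\<Sum>\<tau>\<in>UNIV. \<Sum>\<beta>\<in>UNIV. hess_inv h x \<rho> \<tau> * h3 h x \<tau> \<nu> \<beta> * h_udd h x \<beta> \<mu> \<sigma>)
     = - (\<Sum>\<beta>\<in>UNIV. h_udd h x \<rho> \<nu> \<beta> * h_udd h x \<beta> \<mu> \<sigma>)"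
    by (subst sum.swap) (simp add: h_udd_def[of h x \<rho> \<nu>] sum_distrib_right[symmetric] sum_negf)
  finally show ?thesis by simp
qed

text \<open>Has literally the shape of the claimed right-hand side, so that the final proof closes
  by unfolding it.\<close>

definition riem_formula :: "real^'m \<Rightarrow> 'm \<Rightarrow> 'm \<Rightarrow> 'm \<Rightarrow> 'm \<Rightarrow> real" where
  "riem_formula x \<rho> \<sigma> \<mu> \<nu> = - 1 / (4 * (h x)^2) *
         (- ((h x)^2 * h_uddd h x \<rho> \<sigma> \<mu> \<nu>)
          + 1 / (D - 1) * x $ \<rho> * (h x * h3 h x \<sigma> \<mu> \<nu> - h2 h x \<mu> \<sigma> * h1 h x \<nu>)
          + h1 h x \<mu> * h1 h x \<nu> * kron \<rho> \<sigma>
          + h1 h x \<sigma> * h1 h x \<nu> * kron \<rho> \<mu>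
          - h x * (h2 h x \<sigma> \<nu> * kron \<rho> \<mu> + h2 h x \<mu> \<nu> * kron \<rho> \<sigma>
                   - 1 / (D - 1) * h2 h x \<mu> \<sigma> * kron \<rho> \<nu>)
          - (h x)^2 * (\<Sum>\<beta>\<in>UNIV. h_udd h x \<rho> \<nu> \<beta> * h_udd h x \<beta> \<sigma> \<mu>))"

lemma h_uddd_swap23: "x \<in> U \<Longrightarrow> h_uddd h x \<rho> \<sigma> \<mu> \<nu> = h_uddd h x \<rho> \<mu> \<sigma> \<nu>"
  by (simp add: h_uddd_def h4_swap23[of x _ \<sigma> \<mu>])

lemma h_uddd_swap34: "x \<in> U \<Longrightarrow> h_uddd h x \<rho> \<sigma> \<mu> \<nu> = h_uddd h x \<rho> \<sigma> \<nu> \<mu>"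
  by (simp add: h_uddd_def h4_swap34[of x _ _ \<mu> \<nu>])

lemma pd_christoffel:
  assumes x: "x \<in> U" and diff: "\<And>\<rho>. (\<lambda>x. christoffel h D x \<rho> \<mu> \<sigma>) differentiable (at x)"
  shows "- pd \<nu> (\<lambda>x. christoffel h D x \<rho> \<mu> \<sigma>) x / 4 = riem_formula x \<rho> \<sigma> \<mu> \<nu>"
proof -
  have dx: "(\<lambda>x::real^'m. x $ \<rho>) differentiable (at x)" for \<rho>
    using has_derivative_component differentiable_def by blast
  \<comment> \<open>Differentiability passes from \<open>christoffel\<close> to
    \<open>h_udd\<close>, not conversely: the former will be known from the smoothness of the
    connection, and all other terms are derivatives of h, 1 / h and coordinates.\<close>
  have "(\<lambda>x. h_udd h x \<rho> \<mu> \<sigma>) differentiable (at x)" for \<rho>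
  proof -
    have "h_udd h x \<rho> \<mu> \<sigma> = - christoffel h D x \<rho> \<mu> \<sigma>
       - (kron \<rho> \<mu> * h1 h x \<sigma> + kron \<rho> \<sigma> * h1 h x \<mu>) * inverse (h x)
       + x $ \<rho> * h2 h x \<mu> \<sigma> * inverse (h x) * inverse (D - 1)" for x
      by (simp add: christoffel_eq)
    then show ?thesis
      using x
      by (simp only:) (intro differentiable_add differentiable_diff differentiable_minus differentiable_mult
        differentiable_derivs differentiable_inverse_h differentiable_const diff dx)
  qed
  note d = differentiable_derivs[OF x] differentiable_inverse_h[OF x] dx this
  have pd_eq: "pd \<nu> (\<lambda>x. christoffel h D x \<rho> \<mu> \<sigma>) x
     = - (h_uddd h x \<rho> \<nu> \<mu> \<sigma> + (\<Sum>\<beta>\<in>UNIV. h_udd h x \<rho> \<nu> \<beta> * h_udd h x \<beta> \<mu> \<sigma>))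
     - ((kron \<rho> \<mu> * h2 h x \<nu> \<sigma> + kron \<rho> \<sigma> * h2 h x \<nu> \<mu>) * inverse (h x)
        + (kron \<rho> \<mu> * h1 h x \<sigma> + kron \<rho> \<sigma> * h1 h x \<mu>) * (- h1 h x \<nu> / (h x)\<^sup>2))
     + ((kron \<nu> \<rho> * h2 h x \<mu> \<sigma> + x $ \<rho> * h3 h x \<nu> \<mu> \<sigma>) * inverse (h x)
        + x $ \<rho> * h2 h x \<mu> \<sigma> * (- h1 h x \<nu> / (h x)\<^sup>2)) * inverse (D - 1)"
    unfolding christoffel_eq
    by (simp only: pd_add pd_diff pd_uminus pd_mult pd_inverse pd_derivs pd_const pd_vec_nth d
        differentiable_mult differentiable_minus differentiable_add differentiable_diff
        differentiable_const pd_h_udd[OF x]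
        nonzero(1)[OF x] nonzero(2) not_False_eq_True simp_thms mult_zero_left mult_zero_right add_0_left add_0_right)
  have h_uddd_eq: "h_uddd h x \<rho> \<nu> \<mu> \<sigma> = h_uddd h x \<rho> \<sigma> \<mu> \<nu>"
    using h_uddd_swap23[OF x] h_uddd_swap34[OF x] by metis
  have h3_eq: "h3 h x \<nu> \<mu> \<sigma> = h3 h x \<sigma> \<mu> \<nu>"
    using h3_swap12[OF x] h3_swap23[OF x] by metis
  obtain E where E: "E \<noteq> 0" "D = E + 1"
    using nonzero(2) by (metis diff_add_cancel)
  show ?thesis
    unfolding pd_eq h_uddd_eq h3_eq riem_formula_def h_udd_commute[OF x, of _ \<mu> \<sigma>]
      h2_commute[OF x, of \<nu>] kron_commute[of \<nu>]
    using nonzero(1)[OF x] E(1) by (simp add: E(2) field_simps power2_eq_square)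
qed

end

section \<open>Contractions of the curvature\<close>

context r_map_domain
begin

lemma h_duu_eq:
  assumes x: "x \<in> U"
  shows "h_duu h x \<mu> \<alpha> \<beta> = - (\<Sum>\<rho>\<in>UNIV. hess_inv h x \<alpha> \<rho> * h_udd h x \<beta> \<mu> \<rho>)"
proof -
  have h3_eq: "h3 h x \<kappa> \<mu> \<rho> = h3 h x \<mu> \<rho> \<kappa>" for \<kappa> \<rho>
    using h3_swap12[OF x] h3_swap23[OF x] by metis
  show ?thesis
    by (simp add: h_duu_def h_udd_def h3_eq sum_negf sum_distrib_left mult.assoc)
qed

lemma h_uuu_eq: "h_uuu h x \<alpha> \<beta> \<gamma> = - (\<Sum>\<rho>\<in>UNIV. hess_inv h x \<alpha> \<rho> * h_duu h x \<rho> \<beta> \<gamma>)"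
  by (simp add: h_uuu_def h_duu_def sum_distrib_left mult.assoc)

text \<open>The left side is the trace of a product of two endomorphisms. Moving the inverse Hessian
  of the first factor over to the second turns it into a full contraction of third
  derivatives.\<close>

lemma h_udd_h_udd:
  assumes x: "x \<in> U"
  shows "(\<Sum>\<rho>\<in>UNIV. \<Sum>\<beta>\<in>UNIV. h_udd h x \<rho> \<nu> \<beta> * h_udd h x \<beta> \<mu> \<rho>)
    = (\<Sum>\<alpha>\<in>UNIV. \<Sum>\<beta>\<in>UNIV. h_duu h x \<mu> \<alpha> \<beta> * h3 h x \<alpha> \<beta> \<nu>)"
proof -
  have udd: "h_udd h x \<rho> \<nu> \<beta> = - (\<Sum>\<alpha>\<in>UNIV. hess_inv h x \<alpha> \<rho> * h3 h x \<alpha> \<beta> \<nu>)" for \<rho> \<beta>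
    by (simp add: h_udd_def hess_inv_commute[OF x, of \<rho>] h3_swap23[OF x, of _ \<nu>])
  have "(\<Sum>\<alpha>\<in>UNIV. \<Sum>\<beta>\<in>UNIV. h_duu h x \<mu> \<alpha> \<beta> * h3 h x \<alpha> \<beta> \<nu>)
    = - (\<Sum>\<alpha>\<in>UNIV. \<Sum>\<beta>\<in>UNIV. \<Sum>\<rho>\<in>UNIV. hess_inv h x \<alpha> \<rho> * h3 h x \<alpha> \<beta> \<nu> * h_udd h x \<beta> \<mu> \<rho>)"
    by (simp add: h_duu_eq[OF x] sum_distrib_left sum_negf ac_simps)
  also have "\<dots> = - (\<Sum>\<beta>\<in>UNIV. \<Sum>\<rho>\<in>UNIV. \<Sum>\<alpha>\<in>UNIV. hess_inv h x \<alpha> \<rho> * h3 h x \<alpha> \<beta> \<nu> * h_udd h x \<beta> \<mu> \<rho>)"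
    by (subst sum.swap, subst (2) sum.swap) simp
  also have "\<dots> = (\<Sum>\<beta>\<in>UNIV. \<Sum>\<rho>\<in>UNIV. h_udd h x \<rho> \<nu> \<beta> * h_udd h x \<beta> \<mu> \<rho>)"
    by (simp add: udd sum_distrib_right sum_negf)
  finally show ?thesis
    by (subst sum.swap) simp
qed

text \<open>After Euler's relations, the lower-order terms without the factor m cancel. Those with
  it come from the trace of the Kronecker delta and form - m times the metric coefficient
  \<open>K2 / 4\<close>.\<close>

lemma contracted_riem_formula:
  assumes x: "x \<in> U"
  shows "(\<Sum>\<rho>\<in>UNIV. riem_formula x \<rho> \<mu> \<rho> \<nu>) = - real CARD('m) * (K2 h x \<mu> \<nu> / 4)
    + (1/4 * (\<Sum>\<alpha>\<in>UNIV. \<Sum>\<beta>\<in>UNIV. h_duu h x \<mu> \<alpha> \<beta> * h3 h x \<alpha> \<beta> \<nu>)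
       + 1/4 * (\<Sum>\<rho>\<in>UNIV. h_uddd h x \<rho> \<rho> \<mu> \<nu>))"
proof -
  define c where "c = 1 / (D - 1)"
  define a where "a = 1 / (4 * (h x)\<^sup>2)"
  define b where "b = 1 / (4 * h x)"
  have b_eq: "b = a * h x"
    using nonzero(1)[OF x] by (simp add: a_def b_def power2_eq_square)
  have h3_eq: "h3 h x \<mu> \<rho> \<nu> = h3 h x \<rho> \<mu> \<nu>" for \<rho>
    using h3_swap12[OF x] .
  have term_eq: "riem_formula x \<rho> \<mu> \<rho> \<nu> = 1/4 * h_uddd h x \<rho> \<rho> \<mu> \<nu>
     - a * c * h x * (x $ \<rho> * h3 h x \<rho> \<mu> \<nu>) + a * c * h1 h x \<nu> * (x $ \<rho> * h2 h x \<rho> \<mu>)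
     - a * h1 h x \<nu> * (h1 h x \<rho> * kron \<rho> \<mu>) - a * h1 h x \<mu> * h1 h x \<nu>
     + b * h2 h x \<mu> \<nu> + b * (h2 h x \<rho> \<nu> * kron \<rho> \<mu>) - b * c * (h2 h x \<rho> \<mu> * kron \<rho> \<nu>)
     + 1/4 * (\<Sum>\<beta>\<in>UNIV. h_udd h x \<rho> \<nu> \<beta> * h_udd h x \<beta> \<mu> \<rho>)" for \<rho>
  proof -
    have "riem_formula x \<rho> \<mu> \<rho> \<nu> = - a *
         (- ((h x)^2 * h_uddd h x \<rho> \<rho> \<mu> \<nu>)
          + c * x $ \<rho> * (h x * h3 h x \<rho> \<mu> \<nu> - h2 h x \<rho> \<mu> * h1 h x \<nu>)
          + h1 h x \<rho> * h1 h x \<nu> * kron \<rho> \<mu>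
          + h1 h x \<mu> * h1 h x \<nu>
          - h x * (h2 h x \<mu> \<nu> + h2 h x \<rho> \<nu> * kron \<rho> \<mu> - c * h2 h x \<rho> \<mu> * kron \<rho> \<nu>)
          - (h x)^2 * (\<Sum>\<beta>\<in>UNIV. h_udd h x \<rho> \<nu> \<beta> * h_udd h x \<beta> \<mu> \<rho>))"
      by (simp add: riem_formula_def a_def c_def h_uddd_swap23[OF x, of _ \<mu>] h3_eq)
    moreover have "a * ((h x)\<^sup>2 * y) = 1/4 * y" for y
      using nonzero(1)[OF x] by (simp add: a_def)
    ultimately show ?thesis
      unfolding b_eq by (simp add: algebra_simps)
  qed
  have "(\<Sum>\<rho>\<in>UNIV. riem_formula x \<rho> \<mu> \<rho> \<nu>) = 1/4 * (\<Sum>\<rho>\<in>UNIV. h_uddd h x \<rho> \<rho> \<mu> \<nu>)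
     - a * c * h x * ((D - 2) * h2 h x \<mu> \<nu>) + a * c * h1 h x \<nu> * ((D - 1) * h1 h x \<mu>)
     - a * h1 h x \<nu> * h1 h x \<mu> - real CARD('m) * (a * h1 h x \<mu> * h1 h x \<nu>)
     + real CARD('m) * (b * h2 h x \<mu> \<nu>) + b * h2 h x \<mu> \<nu> - b * c * h2 h x \<nu> \<mu>
     + 1/4 * (\<Sum>\<alpha>\<in>UNIV. \<Sum>\<beta>\<in>UNIV. h_duu h x \<mu> \<alpha> \<beta> * h3 h x \<alpha> \<beta> \<nu>)"
    unfolding term_eq sum.distrib sum_subtractf sum_distrib_left[symmetric] sum_kron
      euler_derivs[OF x] h_udd_h_udd[OF x, symmetric]
    by simp
  moreover have "c * (D - 1) = 1" using nonzero(2) by (simp add: c_def)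
  then have "a * c * h1 h x \<nu> * ((D - 1) * h1 h x \<mu>) = a * h1 h x \<nu> * h1 h x \<mu>"
    by (simp add: ac_simps)
  \<comment> \<open>Since c (D - 2) = 1 - c, this Euler term cancels the two Hessian terms that come
    from single Kronecker deltas.\<close>
  moreover have "a * c * h x * ((D - 2) * h2 h x \<mu> \<nu>) = b * h2 h x \<mu> \<nu> - b * c * h2 h x \<nu> \<mu>"
  proof -
    have "c * (D - 2) = 1 - c" using \<open>c * (D - 1) = 1\<close> by (simp add: algebra_simps)
    then have "b * (c * (D - 2)) * h2 h x \<mu> \<nu> = b * (1 - c) * h2 h x \<mu> \<nu>" by simp
    then show ?thesis
      by (simp add: b_eq algebra_simps h2_commute[OF x, of \<nu> \<mu>])
  qed
  moreover have "K2 h x \<mu> \<nu> / 4 = a * h1 h x \<mu> * h1 h x \<nu> - b * h2 h x \<mu> \<nu>"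
    by (simp add: K2_def a_def b_def)
  ultimately show ?thesis
    by (simp add: right_diff_distrib)
qed

text \<open>Raising acts on indices other than the one contracted with x, so Euler's relation is
  applied first; when it leaves \<open>h2\<close>, an inverse Hessian reduces that to a Kronecker
  delta.\<close>

lemma euler_raised:
  assumes x: "x \<in> U"
  shows "(\<Sum>\<mu>\<in>UNIV. x $ \<mu> * h_duu h x \<mu> \<alpha> \<beta>) = (D - 2) * hess_inv h x \<alpha> \<beta>"
    and "(\<Sum>\<mu>\<in>UNIV. x $ \<mu> * h_udd h x \<rho> \<sigma> \<mu>) = - (D - 2) * kron \<rho> \<sigma>"
    and "(\<Sum>\<mu>\<in>UNIV. x $ \<mu> * h_uddd h x \<rho> \<sigma> \<mu> \<nu>) = (D - 3) * h_udd h x \<rho> \<sigma> \<nu>"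
proof -
  have e3: "(\<Sum>\<mu>\<in>UNIV. x $ \<mu> * h3 h x \<kappa> \<sigma> \<mu>) = (D - 2) * h2 h x \<kappa> \<sigma>" for \<kappa> \<sigma>
  proof -
    have "h3 h x \<kappa> \<sigma> \<mu> = h3 h x \<mu> \<kappa> \<sigma>" for \<mu>
      using h3_swap12[OF x] h3_swap23[OF x] by metis
    then show ?thesis by (simp add: euler_derivs[OF x])
  qed
  have e4: "(\<Sum>\<mu>\<in>UNIV. x $ \<mu> * h4 h x \<kappa> \<sigma> \<mu> \<nu>) = (D - 3) * h3 h x \<kappa> \<sigma> \<nu>" for \<kappa>
  proof -
    have "h4 h x \<kappa> \<sigma> \<mu> \<nu> = h4 h x \<mu> \<kappa> \<sigma> \<nu>" for \<mu>
      using h4_swap12[OF x] h4_swap23[OF x] by metis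
    then show ?thesis by (simp add: euler_derivs[OF x])
  qed
  show udd: "(\<Sum>\<mu>\<in>UNIV. x $ \<mu> * h_udd h x \<rho> \<sigma> \<mu>) = - (D - 2) * kron \<rho> \<sigma>" for \<rho> \<sigma>
  proof -
    have "(\<Sum>\<mu>\<in>UNIV. x $ \<mu> * h_udd h x \<rho> \<sigma> \<mu>)
      = - (\<Sum>\<kappa>\<in>UNIV. hess_inv h x \<rho> \<kappa> * (\<Sum>\<mu>\<in>UNIV. x $ \<mu> * h3 h x \<kappa> \<sigma> \<mu>))"
      unfolding h_udd_def sum_distrib_left mult_minus_right sum_negf
      by (subst sum.swap) (simp add: ac_simps)
    also have "\<dots> = - ((D - 2) * (\<Sum>\<kappa>\<in>UNIV. hess_inv h x \<rho> \<kappa> * h2 h x \<kappa> \<sigma>))"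
      by (simp add: e3 sum_distrib_left ac_simps)
    finally show ?thesis
      by (simp only: hess_inv_inverse[OF x] minus_mult_left)
  qed
  show "(\<Sum>\<mu>\<in>UNIV. x $ \<mu> * h_uddd h x \<rho> \<sigma> \<mu> \<nu>) = (D - 3) * h_udd h x \<rho> \<sigma> \<nu>"
  proof -
    have "(\<Sum>\<mu>\<in>UNIV. x $ \<mu> * h_uddd h x \<rho> \<sigma> \<mu> \<nu>)
      = - (\<Sum>\<kappa>\<in>UNIV. hess_inv h x \<rho> \<kappa> * (\<Sum>\<mu>\<in>UNIV. x $ \<mu> * h4 h x \<kappa> \<sigma> \<mu> \<nu>))"
      unfolding h_uddd_def sum_distrib_left mult_minus_right sum_negf
      by (subst sum.swap) (simp add: ac_simps)
    then show ?thesis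
      by (simp add: e4 h_udd_def sum_distrib_left ac_simps)
  qed
  show "(\<Sum>\<mu>\<in>UNIV. x $ \<mu> * h_duu h x \<mu> \<alpha> \<beta>) = (D - 2) * hess_inv h x \<alpha> \<beta>"
  proof -
    have "(\<Sum>\<mu>\<in>UNIV. x $ \<mu> * h_duu h x \<mu> \<alpha> \<beta>)
      = - (\<Sum>\<rho>\<in>UNIV. hess_inv h x \<alpha> \<rho> * (\<Sum>\<mu>\<in>UNIV. x $ \<mu> * h_udd h x \<beta> \<rho> \<mu>))"
      unfolding h_duu_eq[OF x] sum_distrib_left mult_minus_right sum_negf
      by (subst sum.swap) (simp add: ac_simps h_udd_commute[OF x, of \<beta>])
    also have "\<dots> = (D - 2) * (\<Sum>\<rho>\<in>UNIV. hess_inv h x \<alpha> \<rho> * kron \<beta> \<rho>)"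
      unfolding udd sum_distrib_left sum_negf[symmetric] by (simp add: algebra_simps)
    finally show ?thesis by simp
  qed
qed

lemma sum_sum_K2_inv:
  "(\<Sum>\<nu>\<in>UNIV. \<Sum>\<mu>\<in>UNIV. K2_inv h D x \<nu> \<mu> * T \<mu> \<nu>)
    = - h x * (\<Sum>\<nu>\<in>UNIV. \<Sum>\<mu>\<in>UNIV. hess_inv h x \<nu> \<mu> * T \<mu> \<nu>)
      + 1 / (D - 1) * (\<Sum>\<nu>\<in>UNIV. \<Sum>\<mu>\<in>UNIV. x $ \<mu> * x $ \<nu> * T \<mu> \<nu>)"
  unfolding sum_K2_inv sum.distrib by (simp add: sum_distrib_left ac_simps)

text \<open>The metric term gives - m times the trace of the identity. In the rest, the part
  \<open>- h x * hess_inv\<close> of \<open>K2_inv\<close> yields the two contractions of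
  derivatives of h, while the x x part is evaluated by Euler's relations to ((D - 2)^2 - (D - 2)(D -
  3)) m / (D - 1) = (D - 2) m / (D - 1).\<close>

lemma contracted_ricci:
  assumes x: "x \<in> U"
  shows "(\<Sum>\<nu>\<in>UNIV. \<Sum>\<mu>\<in>UNIV. K2_inv h D x \<nu> \<mu> *
      (- real CARD('m) * K2 h x \<mu> \<nu>
       + ((\<Sum>\<alpha>\<in>UNIV. \<Sum>\<beta>\<in>UNIV. h_duu h x \<mu> \<alpha> \<beta> * h3 h x \<alpha> \<beta> \<nu>)
       + (\<Sum>\<rho>\<in>UNIV. h_uddd h x \<rho> \<rho> \<mu> \<nu>))))
    = - ((real CARD('m))^2) + (D - 2) / (D - 1) * real CARD('m)
        + h x * (\<Sum>\<alpha>\<in>UNIV. \<Sum>\<beta>\<in>UNIV. \<Sum>\<gamma>\<in>UNIV. h3 h x \<alpha> \<beta> \<gamma> * h_uuu h x \<alpha> \<beta> \<gamma>)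
        + h x * (\<Sum>\<mu>\<in>UNIV. \<Sum>\<nu>\<in>UNIV. h_uudd h x \<mu> \<nu> \<mu> \<nu>)"
proof -
  define A where "A \<mu> \<nu> = (\<Sum>\<alpha>\<in>UNIV. \<Sum>\<beta>\<in>UNIV. h_duu h x \<mu> \<alpha> \<beta> * h3 h x \<alpha> \<beta> \<nu>)" for \<mu> \<nu>
  define B where "B \<mu> \<nu> = (\<Sum>\<rho>\<in>UNIV. h_uddd h x \<rho> \<rho> \<mu> \<nu>)" for \<mu> \<nu>
  let ?m = "real CARD('m)"
  have h3_rot: "h3 h x \<alpha> \<beta> \<nu> = h3 h x \<nu> \<alpha> \<beta>" for \<alpha> \<beta> \<nu>
    using h3_swap12[OF x] h3_swap23[OF x] by metis
  have h4_rot: "h4 h x \<kappa> \<rho> \<mu> \<nu> = h4 h x \<mu> \<kappa> \<nu> \<rho>" for \<kappa> \<rho> \<mu> \<nu>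
    using h4_swap12[OF x] h4_swap23[OF x] h4_swap34[OF x] by metis
  have 1: "(\<Sum>\<nu>\<in>UNIV. \<Sum>\<mu>\<in>UNIV. hess_inv h x \<nu> \<mu> * A \<mu> \<nu>)
     = - (\<Sum>\<alpha>\<in>UNIV. \<Sum>\<beta>\<in>UNIV. \<Sum>\<gamma>\<in>UNIV. h3 h x \<alpha> \<beta> \<gamma> * h_uuu h x \<alpha> \<beta> \<gamma>)"
  proof -
    have "(\<Sum>\<mu>\<in>UNIV. hess_inv h x \<nu> \<mu> * A \<mu> \<nu>)
      = - (\<Sum>\<beta>\<in>UNIV. \<Sum>\<gamma>\<in>UNIV. h3 h x \<nu> \<beta> \<gamma> * h_uuu h x \<nu> \<beta> \<gamma>)" for \<nu>
    proof -
      have "(\<Sum>\<mu>\<in>UNIV. hess_inv h x \<nu> \<mu> * A \<mu> \<nu>)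
        = (\<Sum>\<mu>\<in>UNIV. \<Sum>\<beta>\<in>UNIV. \<Sum>\<gamma>\<in>UNIV. h3 h x \<nu> \<beta> \<gamma> * (hess_inv h x \<nu> \<mu> * h_duu h x \<mu> \<beta> \<gamma>))"
        unfolding A_def sum_distrib_left by (simp add: h3_rot[of _ _ \<nu>] ac_simps)
      also have "\<dots> = (\<Sum>\<beta>\<in>UNIV. \<Sum>\<gamma>\<in>UNIV. \<Sum>\<mu>\<in>UNIV. h3 h x \<nu> \<beta> \<gamma> * (hess_inv h x \<nu> \<mu> * h_duu h x \<mu> \<beta> \<gamma>))"
        by (subst sum.swap, subst (2) sum.swap) simp
      finally show ?thesis
        by (simp add: h_uuu_eq sum_distrib_left sum_negf)
    qed
    then show ?thesis by (simp add: sum_negf)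
  qed
  have 2: "(\<Sum>\<nu>\<in>UNIV. \<Sum>\<mu>\<in>UNIV. hess_inv h x \<nu> \<mu> * B \<mu> \<nu>)
     = - (\<Sum>\<mu>\<in>UNIV. \<Sum>\<nu>\<in>UNIV. h_uudd h x \<mu> \<nu> \<mu> \<nu>)"
  proof -
    have "(\<Sum>\<mu>\<in>UNIV. hess_inv h x \<nu> \<mu> * B \<mu> \<nu>) = - (\<Sum>\<rho>\<in>UNIV. h_uudd h x \<nu> \<rho> \<nu> \<rho>)" for \<nu>
    proof -
      have "(\<Sum>\<mu>\<in>UNIV. hess_inv h x \<nu> \<mu> * B \<mu> \<nu>)
        = - (\<Sum>\<mu>\<in>UNIV. \<Sum>\<rho>\<in>UNIV. \<Sum>\<kappa>\<in>UNIV. hess_inv h x \<nu> \<mu> * hess_inv h x \<rho> \<kappa> * h4 h x \<mu> \<kappa> \<nu> \<rho>)"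
        unfolding B_def h_uddd_def sum_distrib_left
        by (simp add: h4_rot[of _ _ _ \<nu>] sum_negf sum_distrib_left mult.assoc)
      also have "\<dots> = - (\<Sum>\<rho>\<in>UNIV. \<Sum>\<mu>\<in>UNIV. \<Sum>\<kappa>\<in>UNIV. hess_inv h x \<nu> \<mu> * hess_inv h x \<rho> \<kappa> * h4 h x \<mu> \<kappa> \<nu> \<rho>)"
        by (subst sum.swap) simp
      finally show ?thesis by (simp add: h_uudd_def)
    qed
    then show ?thesis by (simp add: sum_negf)
  qed
  have 3: "(\<Sum>\<nu>\<in>UNIV. \<Sum>\<mu>\<in>UNIV. x $ \<mu> * x $ \<nu> * A \<mu> \<nu>) = (D - 2)\<^sup>2 * ?m"
  proof -
    have "(\<Sum>\<mu>\<in>UNIV. x $ \<mu> * x $ \<nu> * A \<mu> \<nu>)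
       = (\<Sum>\<alpha>\<in>UNIV. \<Sum>\<beta>\<in>UNIV. (D - 2) * hess_inv h x \<alpha> \<beta> * (x $ \<nu> * h3 h x \<nu> \<alpha> \<beta>))" for \<nu>
    proof -
      have "(\<Sum>\<mu>\<in>UNIV. x $ \<mu> * x $ \<nu> * A \<mu> \<nu>) = (\<Sum>\<mu>\<in>UNIV. \<Sum>\<alpha>\<in>UNIV. \<Sum>\<beta>\<in>UNIV.
          (x $ \<mu> * h_duu h x \<mu> \<alpha> \<beta>) * (x $ \<nu> * h3 h x \<nu> \<alpha> \<beta>))"
        unfolding A_def sum_distrib_left by (simp add: h3_rot[of _ _ \<nu>] ac_simps)
      also have "\<dots> = (\<Sum>\<alpha>\<in>UNIV. \<Sum>\<beta>\<in>UNIV. \<Sum>\<mu>\<in>UNIV.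
          (x $ \<mu> * h_duu h x \<mu> \<alpha> \<beta>) * (x $ \<nu> * h3 h x \<nu> \<alpha> \<beta>))"
        by (subst sum.swap, subst (2) sum.swap) simp
      finally show ?thesis
        by (simp only: sum_distrib_right[symmetric] euler_raised[OF x])
    qed
    then have "(\<Sum>\<nu>\<in>UNIV. \<Sum>\<mu>\<in>UNIV. x $ \<mu> * x $ \<nu> * A \<mu> \<nu>)
       = (\<Sum>\<nu>\<in>UNIV. \<Sum>\<alpha>\<in>UNIV. \<Sum>\<beta>\<in>UNIV. (D - 2) * hess_inv h x \<alpha> \<beta> * (x $ \<nu> * h3 h x \<nu> \<alpha> \<beta>))"
      by simp
    also have "\<dots> = (\<Sum>\<alpha>\<in>UNIV. \<Sum>\<beta>\<in>UNIV. \<Sum>\<nu>\<in>UNIV. (D - 2) * hess_inv h x \<alpha> \<beta> * (x $ \<nu> * h3 h x \<nu> \<alpha> \<beta>))"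
      by (subst sum.swap, subst (2) sum.swap) simp
    also have "\<dots> = (\<Sum>\<alpha>\<in>UNIV. \<Sum>\<beta>\<in>UNIV. (D - 2) * hess_inv h x \<alpha> \<beta> * ((D - 2) * h2 h x \<beta> \<alpha>))"
      by (simp only: sum_distrib_left[symmetric] euler_derivs[OF x] h2_commute[OF x])
    also have "\<dots> = (D - 2)\<^sup>2 * (\<Sum>\<alpha>\<in>UNIV. \<Sum>\<beta>\<in>UNIV. hess_inv h x \<alpha> \<beta> * h2 h x \<beta> \<alpha>)"
      by (simp add: sum_distrib_left power2_eq_square ac_simps)
    finally show ?thesis
      by (simp add: hess_inv_inverse[OF x])
  qed
  have 4: "(\<Sum>\<nu>\<in>UNIV. \<Sum>\<mu>\<in>UNIV. x $ \<mu> * x $ \<nu> * B \<mu> \<nu>) = - (D - 2) * (D - 3) * ?m"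
  proof -
    have "(\<Sum>\<mu>\<in>UNIV. x $ \<mu> * x $ \<nu> * B \<mu> \<nu>) = (\<Sum>\<rho>\<in>UNIV. (D - 3) * (x $ \<nu> * h_udd h x \<rho> \<rho> \<nu>))" for \<nu>
    proof -
      have "(\<Sum>\<mu>\<in>UNIV. x $ \<mu> * x $ \<nu> * B \<mu> \<nu>)
         = (\<Sum>\<rho>\<in>UNIV. x $ \<nu> * (\<Sum>\<mu>\<in>UNIV. x $ \<mu> * h_uddd h x \<rho> \<rho> \<mu> \<nu>))"
        unfolding B_def sum_distrib_left by (subst sum.swap) (simp add: ac_simps)
      then show ?thesis by (simp add: euler_raised[OF x] ac_simps)
    qed
    then have "(\<Sum>\<nu>\<in>UNIV. \<Sum>\<mu>\<in>UNIV. x $ \<mu> * x $ \<nu> * B \<mu> \<nu>)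
       = (\<Sum>\<rho>\<in>UNIV. (D - 3) * (\<Sum>\<nu>\<in>UNIV. x $ \<nu> * h_udd h x \<rho> \<rho> \<nu>))"
      unfolding sum_distrib_left by (subst sum.swap) simp
    then show ?thesis by (simp add: euler_raised[OF x])
  qed
  have 5: "(\<Sum>\<nu>\<in>UNIV. \<Sum>\<mu>\<in>UNIV. K2_inv h D x \<nu> \<mu> * (- ?m * K2 h x \<mu> \<nu>)) = - ?m\<^sup>2"
  proof -
    have "(\<Sum>\<nu>\<in>UNIV. \<Sum>\<mu>\<in>UNIV. K2_inv h D x \<nu> \<mu> * (- ?m * K2 h x \<mu> \<nu>))
      = - ?m * (\<Sum>\<nu>\<in>UNIV. \<Sum>\<mu>\<in>UNIV. K2_inv h D x \<nu> \<mu> * K2 h x \<mu> \<nu>)"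
      by (simp add: sum_distrib_left ac_simps)
    then show ?thesis by (simp add: K2_inv_K2[OF x] power2_eq_square)
  qed
  have 6: "1 / (D - 1) * ((D - 2)\<^sup>2 * ?m) + 1 / (D - 1) * (- (D - 2) * (D - 3) * ?m)
     = (D - 2) / (D - 1) * ?m"
  proof -
    have "(D - 2)\<^sup>2 * ?m + - (D - 2) * (D - 3) * ?m = (D - 2) * ?m"
      by (simp add: algebra_simps power2_eq_square)
    then show ?thesis
      unfolding distrib_left[symmetric] by simp
  qed
  show ?thesis
    unfolding A_def[symmetric] B_def[symmetric] distrib_left[of "K2_inv h D x _ _"] sum.distrib 5
      sum_sum_K2_inv 1 2 3 4
    using 6 by (simp add: algebra_simps)
qed

end

section \<open>The Levi-Civita connection of the r-map metric\<close>

lemma sum_rotate: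
  "(\<Sum>a\<in>A. \<Sum>b\<in>B. \<Sum>c\<in>C. f a b c) = (\<Sum>b\<in>B. \<Sum>c\<in>C. \<Sum>a\<in>A. f a b c)"
  by (subst sum.swap, subst (2) sum.swap) simp

lemma bounded_linear_im_part: "bounded_linear (im_part :: complex^'m::finite \<Rightarrow> real^'m)"
  by (auto intro!: linearI simp: linear_conv_bounded_linear[symmetric] im_part_def vec_eq_iff)

lemma im_part_nth [simp]: "im_part z $ \<mu> = Im (z $ \<mu>)"
  by (simp add: im_part_def)

lemma Re_of_real_mult: "Re (of_real r * z) = r * Re z"
  and Im_of_real_mult: "Im (of_real r * z) = r * Im z"
  by simp_all

lemma open_tube_domain: "open U \<Longrightarrow> open (tube_domain U)"
proof -
  assume "open U"
  have "continuous_on UNIV (im_part :: complex^'m \<Rightarrow> real^'m)"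
    by (rule linear_continuous_on[OF bounded_linear_im_part])
  then have "open (im_part -` U)"
    using \<open>open U\<close> open_vimage by blast
  then show ?thesis
    by (simp add: tube_domain_def vimage_def)
qed

lemma has_derivative_im_part:
  assumes "f differentiable (at (im_part z))"
  shows "((\<lambda>z. f (im_part z)) has_derivative (\<lambda>v. frechet_derivative f (at (im_part z)) (im_part v))) (at z)"
  by (rule has_derivative_compose[OF bounded_linear_imp_has_derivative[OF bounded_linear_im_part]
        differentiable_has_derivative[OF assms]])

lemma has_derivative_of_real_im_part:
  fixes f :: "real^'m::finite \<Rightarrow> real" and c :: complex
  assumes "f differentiable (at (im_part z))"
  shows "((\<lambda>z. c * of_real (f (im_part z))) has_derivative
     (\<lambda>v. c * of_real (\<Sum>\<alpha>\<in>UNIV. Im (v $ \<alpha>) * pd \<alpha> f (im_part z)))) (at z)"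
  using has_derivative_mult_right[OF has_derivative_of_real[OF has_derivative_im_part[OF assms]], of c]
  by (simp only: frechet_derivative_pd_sum[OF assms] im_part_nth)

lemma d_z_of_real_im_part:
  fixes f :: "real^'m::finite \<Rightarrow> real"
  assumes "f differentiable (at (im_part z))"
  shows "d_z \<mu> (\<lambda>z. c * of_real (f (im_part z))) z = - \<i> / 2 * c * of_real (pd \<mu> f (im_part z))"
    and "d_zbar \<mu> (\<lambda>z. c * of_real (f (im_part z))) z = \<i> / 2 * c * of_real (pd \<mu> f (im_part z))"
proof -
  have 1: "(\<Sum>\<alpha>\<in>UNIV. Im (axis \<mu> 1 $ \<alpha>) * pd \<alpha> f (im_part z)) = 0"
    by (rule sum.neutral) (simp add: axis_def)
  have "Im (axis \<mu> \<i> $ \<alpha>) = kron \<alpha> \<mu>" for \<alpha>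
    by (simp add: axis_def kron_def)
  then have 2: "(\<Sum>\<alpha>\<in>UNIV. Im (axis \<mu> \<i> $ \<alpha>) * pd \<alpha> f (im_part z)) = pd \<mu> f (im_part z)"
    by simp
  show "d_z \<mu> (\<lambda>z. c * of_real (f (im_part z))) z = - \<i> / 2 * c * of_real (pd \<mu> f (im_part z))"
    and "d_zbar \<mu> (\<lambda>z. c * of_real (f (im_part z))) z = \<i> / 2 * c * of_real (pd \<mu> f (im_part z))"
    unfolding d_z_def d_zbar_def frechet_derivative_eqI[OF has_derivative_of_real_im_part[OF assms]] 1 2
    by simp_all
qed

lemma d_z_cong_open:
  "open S \<Longrightarrow> z \<in> S \<Longrightarrow> (\<And>w. w \<in> S \<Longrightarrow> f w = g w) \<Longrightarrow> d_z \<mu> f z = d_z \<mu> g z"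
  unfolding d_z_def using frechet_derivative_cong_open[of S z f g] by simp

text \<open>Twice the r-map metric at a point with imaginary part x; the factor is irrelevant for
  the Levi-Civita connection.\<close>

definition K_form :: "(real^'m::finite \<Rightarrow> real) \<Rightarrow> real^'m \<Rightarrow> complex^'m \<Rightarrow> complex^'m \<Rightarrow> real" where
  "K_form h x v w = (\<Sum>\<mu>\<in>UNIV. \<Sum>\<nu>\<in>UNIV. K2 h x \<mu> \<nu> * Re (v $ \<mu> * cnj (w $ \<nu>)))"

text \<open>The derivative of \<open>K_form\<close> in the base direction u. Only Im u occurs
  because the coefficients do not depend on the real parts of the coordinates.\<close>

definition K_form_deriv :: "(real^'m::finite \<Rightarrow> real) \<Rightarrow> real^'m \<Rightarrow> complex^'m \<Rightarrow> complex^'m \<Rightarrow> complex^'m \<Rightarrow> real" where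
  "K_form_deriv h x u v w =
     (\<Sum>\<alpha>\<in>UNIV. \<Sum>\<mu>\<in>UNIV. \<Sum>\<nu>\<in>UNIV. K3 h x \<alpha> \<mu> \<nu> * (Im (u $ \<alpha>) * Re (v $ \<mu> * cnj (w $ \<nu>))))"

definition nabla_coord :: "(real^'m::finite \<Rightarrow> real) \<Rightarrow> real \<Rightarrow> real^'m \<Rightarrow> complex^'m \<Rightarrow> complex^'m \<Rightarrow> complex^'m" where
  "nabla_coord h D x v w =
     (\<chi> \<rho>. - \<i> / 2 * (\<Sum>\<mu>\<in>UNIV. \<Sum>\<sigma>\<in>UNIV. of_real (christoffel h D x \<rho> \<mu> \<sigma>) * (v $ \<mu> * w $ \<sigma>)))"

lemma K_form_add_left: "K_form h x (v + v') w = K_form h x v w + K_form h x v' w"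
  by (simp add: K_form_def algebra_simps sum.distrib)

lemma K_form_diff_left: "K_form h x (v - v') w = K_form h x v w - K_form h x v' w"
  by (simp add: K_form_def algebra_simps sum.distrib sum_subtractf)

context r_map_domain
begin

lemma kaehler_matrix_eq:
  assumes z: "z \<in> tube_domain U"
  shows "kaehler_matrix h z $ \<mu> $ \<nu> = of_real (K2 h (im_part z) \<mu> \<nu> / 4)"
proof -
  have U: "im_part w \<in> U" if "w \<in> tube_domain U" for w
    using that by (simp add: tube_domain_def)
  note x = U[OF z]
  have zbar: "d_zbar \<nu> (kaehler_potential h) w
      = \<i> / 2 * of_real (- (h1 h (im_part w) \<nu> * inverse (h (im_part w))))" if w: "w \<in> tube_domain U" for w
  proof -
    have diff: "(\<lambda>x. ln (h x)) differentiable (at (im_part w))"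
      using has_derivative_ln[OF pos[OF U[OF w]] differentiable_has_derivative[OF differentiable_derivs(1)[OF U[OF w]]]]
        differentiable_def by blast
    have "d_zbar \<nu> (kaehler_potential h) w = d_zbar \<nu> (\<lambda>z. (- 1) * of_real (ln (h (im_part z)))) w"
      by (simp add: kaehler_potential_def[abs_def])
    also have "\<dots> = \<i> / 2 * (- 1) * of_real (pd \<nu> (\<lambda>x. ln (h x)) (im_part w))"
      by (rule d_z_of_real_im_part(2)[OF diff])
    finally show ?thesis
      unfolding pd_ln[OF differentiable_derivs(1)[OF U[OF w]] pos[OF U[OF w]]] pd_derivs
      by (simp add: divide_inverse[of "h1 h (im_part w) \<nu>"])
  qed
  note d = differentiable_derivs[OF x] differentiable_inverse_h[OF x]
  have "kaehler_matrix h z $ \<mu> $ \<nu> = d_z \<mu> (d_zbar \<nu> (kaehler_potential h)) z"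
    by (simp add: kaehler_matrix_def)
  also have "\<dots> = d_z \<mu> (\<lambda>w. \<i> / 2 * of_real (- (h1 h (im_part w) \<nu> * inverse (h (im_part w))))) z"
    by (rule d_z_cong_open[OF open_tube_domain[OF open_U] z zbar])
  also have "\<dots> = - \<i> / 2 * (\<i> / 2) * of_real (pd \<mu> (\<lambda>x. - (h1 h x \<nu> * inverse (h x))) (im_part z))"
    by (rule d_z_of_real_im_part(1)) (intro differentiable_minus differentiable_mult d)
  also have "pd \<mu> (\<lambda>x. - (h1 h x \<nu> * inverse (h x))) (im_part z) = K2 h (im_part z) \<mu> \<nu>"
    using nonzero(1)[OF x]
    by (simp add: pd_uminus pd_mult pd_inverse d differentiable_mult pd_derivs K2_def)
       (simp add: field_simps power2_eq_square)
  finally show ?thesis by simp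
qed

lemma r_map_metric_eq:
  assumes z: "z \<in> tube_domain U"
  shows "r_map_metric h z v w = K_form h (im_part z) v w / 2"
proof -
  have x: "im_part z \<in> U" using z by (simp add: tube_domain_def)
  let ?k = "K2 h (im_part z)"
  have "r_map_metric h z v w = (\<Sum>\<mu>\<in>UNIV. \<Sum>\<nu>\<in>UNIV. ?k \<mu> \<nu> / 4 *
      (Re (v $ \<mu> * cnj (w $ \<nu>)) + Re (w $ \<mu> * cnj (v $ \<nu>))))"
    unfolding r_map_metric_def kaehler_matrix_eq[OF z] Re_sum by (simp only: Re_of_real_mult plus_complex.sel)
  also have "\<dots> = (\<Sum>\<mu>\<in>UNIV. \<Sum>\<nu>\<in>UNIV. ?k \<mu> \<nu> / 4 * Re (v $ \<mu> * cnj (w $ \<nu>)))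
      + (\<Sum>\<mu>\<in>UNIV. \<Sum>\<nu>\<in>UNIV. ?k \<mu> \<nu> / 4 * Re (w $ \<mu> * cnj (v $ \<nu>)))"
    by (simp only: distrib_left sum.distrib)
  also have "(\<Sum>\<mu>\<in>UNIV. \<Sum>\<nu>\<in>UNIV. ?k \<mu> \<nu> / 4 * Re (w $ \<mu> * cnj (v $ \<nu>)))
      = (\<Sum>\<mu>\<in>UNIV. \<Sum>\<nu>\<in>UNIV. ?k \<mu> \<nu> / 4 * Re (v $ \<mu> * cnj (w $ \<nu>)))"
    by (subst sum.swap) (simp add: K2_commute[OF x] mult.commute)
  finally show ?thesis
    by (simp add: K_form_def sum_divide_distrib sum.distrib[symmetric])
qed

lemma K_form_commute: "x \<in> U \<Longrightarrow> K_form h x v w = K_form h x w v"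
  unfolding K_form_def by (subst sum.swap) (simp add: K2_commute[of x] mult.commute)

lemma K_form_deriv_commute: "x \<in> U \<Longrightarrow> K_form_deriv h x u v w = K_form_deriv h x u w v"
  unfolding K_form_deriv_def by (subst (2) sum.swap) (simp add: K3_swap23[of x] mult.commute)

text \<open>The test vectors \<open>axis \<nu> 1\<close> and \<open>axis \<nu> \<i>\<close> isolate
  the real and the imaginary parts of a, and \<open>K2\<close> is nondegenerate on each.\<close>

lemma K_form_nondegenerate:
  assumes x: "x \<in> U" and a: "\<And>w. K_form h x a w = 0"
  shows "a = 0"
proof -
  have axis: "K_form h x a (axis \<nu> c) = (\<Sum>\<mu>\<in>UNIV. K2 h x \<nu> \<mu> * Re (a $ \<mu> * cnj c))" for \<nu> c
  proof -
    have "K2 h x \<mu> \<tau> * Re (a $ \<mu> * cnj (axis \<nu> c $ \<tau>)) = (K2 h x \<mu> \<tau> * Re (a $ \<mu> * cnj c)) * kron \<tau> \<nu>" for \<mu> \<tau>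
      by (simp add: axis_def kron_def)
    then have "K_form h x a (axis \<nu> c) = (\<Sum>\<mu>\<in>UNIV. K2 h x \<mu> \<nu> * Re (a $ \<mu> * cnj c))"
      by (simp only: K_form_def sum_kron)
    then show ?thesis
      by (simp only: K2_commute[OF x, of _ \<nu>])
  qed
  have "Re (a $ \<mu>) = 0" for \<mu>
    using a axis[of _ 1] by (intro K2_nondegenerate[OF x, of "\<lambda>\<mu>. Re (a $ \<mu>)"]) simp
  moreover have "Im (a $ \<mu>) = 0" for \<mu>
    using a axis[of _ \<i>] by (intro K2_nondegenerate[OF x, of "\<lambda>\<mu>. Im (a $ \<mu>)"]) simp
  ultimately show ?thesis
    by (simp add: vec_eq_iff complex_eq_iff)
qed

text \<open>\<open>K2\<close> contracts the Christoffel coefficients to \<open>K3\<close>, and the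
  factor \<open>- \<i> / 2\<close> turns the real part of the triple product into half its imaginary
  part.\<close>

lemma K_form_nabla:
  assumes x: "x \<in> U"
  shows "K_form h x (nabla_coord h D x u v) w =
    (\<Sum>\<mu>\<in>UNIV. \<Sum>\<sigma>\<in>UNIV. \<Sum>\<tau>\<in>UNIV. K3 h x \<mu> \<sigma> \<tau> * Im (u $ \<mu> * v $ \<sigma> * cnj (w $ \<tau>))) / 2"
proof -
  have Re_nabla_coord: "Re (nabla_coord h D x u v $ \<rho> * cnj c)
     = (\<Sum>\<mu>\<in>UNIV. \<Sum>\<sigma>\<in>UNIV. christoffel h D x \<rho> \<mu> \<sigma> * Im (u $ \<mu> * v $ \<sigma> * cnj c)) / 2" for \<rho> c
  proof -
    have "nabla_coord h D x u v $ \<rho> * cnj c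
       = - \<i> / 2 * (\<Sum>\<mu>\<in>UNIV. \<Sum>\<sigma>\<in>UNIV. of_real (christoffel h D x \<rho> \<mu> \<sigma>) * (u $ \<mu> * v $ \<sigma> * cnj c))"
      by (simp add: nabla_coord_def sum_distrib_right mult.assoc)
    then have "Re (nabla_coord h D x u v $ \<rho> * cnj c)
       = Im (\<Sum>\<mu>\<in>UNIV. \<Sum>\<sigma>\<in>UNIV. of_real (christoffel h D x \<rho> \<mu> \<sigma>) * (u $ \<mu> * v $ \<sigma> * cnj c)) / 2"
      by (simp only:) simp
    then show ?thesis
      by (simp only: Im_sum Im_of_real_mult)
  qed
  have K_form_eq: "K_form h x v w = (\<Sum>\<rho>\<in>UNIV. \<Sum>\<tau>\<in>UNIV. K2 h x \<tau> \<rho> * Re (v $ \<rho> * cnj (w $ \<tau>)))" for v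
    unfolding K_form_def by (intro sum.cong refl arg_cong2[where f = "(*)"] K2_commute[OF x])
  have "K_form h x (nabla_coord h D x u v) w = (\<Sum>\<rho>\<in>UNIV. \<Sum>\<tau>\<in>UNIV. \<Sum>\<mu>\<in>UNIV. \<Sum>\<sigma>\<in>UNIV. 
      K2 h x \<tau> \<rho> * christoffel h D x \<rho> \<mu> \<sigma> * Im (u $ \<mu> * v $ \<sigma> * cnj (w $ \<tau>)) / 2)"
    unfolding K_form_eq Re_nabla_coord by (simp only: sum_distrib_left sum_divide_distrib mult.assoc times_divide_eq_right)
  also have "\<dots> = (\<Sum>\<rho>\<in>UNIV. \<Sum>\<mu>\<in>UNIV. \<Sum>\<sigma>\<in>UNIV. \<Sum>\<tau>\<in>UNIV. 
      K2 h x \<tau> \<rho> * christoffel h D x \<rho> \<mu> \<sigma> * Im (u $ \<mu> * v $ \<sigma> * cnj (w $ \<tau>)) / 2)"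
    by (intro sum.cong refl sum_rotate)
  also have "\<dots> = (\<Sum>\<mu>\<in>UNIV. \<Sum>\<sigma>\<in>UNIV. \<Sum>\<rho>\<in>UNIV. \<Sum>\<tau>\<in>UNIV. 
      K2 h x \<tau> \<rho> * christoffel h D x \<rho> \<mu> \<sigma> * Im (u $ \<mu> * v $ \<sigma> * cnj (w $ \<tau>)) / 2)"
    by (rule sum_rotate)
  also have "\<dots> = (\<Sum>\<mu>\<in>UNIV. \<Sum>\<sigma>\<in>UNIV. \<Sum>\<tau>\<in>UNIV. \<Sum>\<rho>\<in>UNIV. 
      K2 h x \<tau> \<rho> * christoffel h D x \<rho> \<mu> \<sigma> * Im (u $ \<mu> * v $ \<sigma> * cnj (w $ \<tau>)) / 2)"
    by (intro sum.cong refl sum.swap)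
  also have "\<dots> = (\<Sum>\<mu>\<in>UNIV. \<Sum>\<sigma>\<in>UNIV. \<Sum>\<tau>\<in>UNIV.
      K3 h x \<tau> \<mu> \<sigma> * Im (u $ \<mu> * v $ \<sigma> * cnj (w $ \<tau>)) / 2)"
    by (simp only: sum_distrib_right[symmetric] sum_divide_distrib[symmetric] K2_christoffel[OF x])
  also have "\<dots> = (\<Sum>\<mu>\<in>UNIV. \<Sum>\<sigma>\<in>UNIV. \<Sum>\<tau>\<in>UNIV.
      K3 h x \<mu> \<sigma> \<tau> * Im (u $ \<mu> * v $ \<sigma> * cnj (w $ \<tau>)) / 2)"
  proof -
    have "K3 h x \<tau> \<mu> \<sigma> = K3 h x \<mu> \<sigma> \<tau>" for \<tau> \<mu> \<sigma>
      using K3_swap12[OF x] K3_swap23[OF x] by metis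
    then show ?thesis
      by (intro sum.cong refl arg_cong2[where f = "(/)"] arg_cong2[where f = "(*)"])
  qed
  finally show ?thesis
    by (simp only: sum_divide_distrib)
qed

text \<open>Total symmetry of \<open>K3\<close> brings all sums to the same coefficients, which
  leaves the identity \<open>im\<close> between three complex numbers.\<close>

lemma koszul_nabla_coord:
  assumes x: "x \<in> U"
  shows "2 * K_form h x (nabla_coord h D x u v) w = K_form_deriv h x u v w + K_form_deriv h x v u w - K_form_deriv h x w u v"
proof -
  have 1: "K_form_deriv h x u v w = (\<Sum>\<mu>\<in>UNIV. \<Sum>\<sigma>\<in>UNIV. \<Sum>\<tau>\<in>UNIV.
     K3 h x \<mu> \<sigma> \<tau> * (Im (u $ \<mu>) * Re (v $ \<sigma> * cnj (w $ \<tau>))))"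
    by (simp add: K_form_deriv_def)
  have 2: "K_form_deriv h x v u w = (\<Sum>\<mu>\<in>UNIV. \<Sum>\<sigma>\<in>UNIV. \<Sum>\<tau>\<in>UNIV.
     K3 h x \<mu> \<sigma> \<tau> * (Im (v $ \<sigma>) * Re (u $ \<mu> * cnj (w $ \<tau>))))"
    unfolding K_form_deriv_def by (subst sum.swap) (simp add: K3_swap12[OF x])
  have 3: "K_form_deriv h x w u v = (\<Sum>\<mu>\<in>UNIV. \<Sum>\<sigma>\<in>UNIV. \<Sum>\<tau>\<in>UNIV.
     K3 h x \<mu> \<sigma> \<tau> * (Im (w $ \<tau>) * Re (u $ \<mu> * cnj (v $ \<sigma>))))"
  proof -
    have rot: "K3 h x \<tau> \<mu> \<sigma> = K3 h x \<mu> \<sigma> \<tau>" for \<tau> \<mu> \<sigma>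
      using K3_swap12[OF x] K3_swap23[OF x] by metis
    have eq: "K_form_deriv h x w u v = (\<Sum>\<tau>\<in>UNIV. \<Sum>\<mu>\<in>UNIV. \<Sum>\<sigma>\<in>UNIV.
       K3 h x \<mu> \<sigma> \<tau> * (Im (w $ \<tau>) * Re (u $ \<mu> * cnj (v $ \<sigma>))))"
      unfolding K_form_deriv_def by (intro sum.cong refl arg_cong2[where f = "(*)"] rot)
    show ?thesis
      unfolding eq by (rule sum_rotate)
  qed
  have im: "Im (a * b * cnj c) = Im a * Re (b * cnj c) + Im b * Re (a * cnj c) - Im c * Re (a * cnj b)" for a b c
    by (simp add: algebra_simps)
  show ?thesis
    unfolding K_form_nabla[OF x] 1 2 3 im distrib_left right_diff_distrib sum.distrib sum_subtractf
    by simp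
qed

text \<open>The sum of the Koszul formulas for (u, v, w) and (u, w, v), in which the remaining
  derivative terms cancel.\<close>

lemma K_form_deriv_compat:
  assumes x: "x \<in> U"
  shows "K_form_deriv h x u v w = K_form h x (nabla_coord h D x u v) w + K_form h x v (nabla_coord h D x u w)"
  using koszul_nabla_coord[OF x, of u v w] koszul_nabla_coord[OF x, of u w v]
    K_form_commute[OF x, of v "nabla_coord h D x u w"] K_form_deriv_commute[OF x] by (smt (verit))

lemma has_derivative_K_form:
  assumes z: "z \<in> tube_domain U" and W: "(W has_derivative W') (at z)"
  shows "((\<lambda>q. K_form h (im_part q) (W q) w) has_derivative
    (\<lambda>u. K_form_deriv h (im_part z) u (W z) w + K_form h (im_part z) (W' u) w)) (at z)"
proof -
  have x: "im_part z \<in> U" using z by (simp add: tube_domain_def)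
  have 1: "((\<lambda>q. K2 h (im_part q) \<mu> \<nu>) has_derivative
      (\<lambda>u. \<Sum>\<alpha>\<in>UNIV. Im (u $ \<alpha>) * K3 h (im_part z) \<alpha> \<mu> \<nu>)) (at z)" for \<mu> \<nu>
    using has_derivative_im_part[OF differentiable_K2[OF x]]
    by (simp only: frechet_derivative_pd_sum[OF differentiable_K2[OF x]] pd_K2[OF x] im_part_nth)
  have 2: "((\<lambda>q. Re (W q $ \<mu> * c)) has_derivative (\<lambda>u. Re (W' u $ \<mu> * c))) (at z)" for \<mu> c
    by (intro has_derivative_Re has_derivative_mult_left bounded_linear.has_derivative[OF bounded_linear_vec_nth] W)
  have "((\<lambda>q. K_form h (im_part q) (W q) w) has_derivative
     (\<lambda>u. \<Sum>\<mu>\<in>UNIV. \<Sum>\<nu>\<in>UNIV. K2 h (im_part z) \<mu> \<nu> * Re (W' u $ \<mu> * cnj (w $ \<nu>))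
        + (\<Sum>\<alpha>\<in>UNIV. Im (u $ \<alpha>) * K3 h (im_part z) \<alpha> \<mu> \<nu>) * Re (W z $ \<mu> * cnj (w $ \<nu>)))) (at z)"
    unfolding K_form_def by (intro has_derivative_sum has_derivative_mult 1 2)
  moreover have "(\<Sum>\<mu>\<in>UNIV. \<Sum>\<nu>\<in>UNIV. K2 h (im_part z) \<mu> \<nu> * Re (W' u $ \<mu> * cnj (w $ \<nu>))
        + (\<Sum>\<alpha>\<in>UNIV. Im (u $ \<alpha>) * K3 h (im_part z) \<alpha> \<mu> \<nu>) * Re (W z $ \<mu> * cnj (w $ \<nu>)))
     = K_form_deriv h (im_part z) u (W z) w + K_form h (im_part z) (W' u) w" for u
  proof -
    have "(\<Sum>\<mu>\<in>UNIV. \<Sum>\<nu>\<in>UNIV. (\<Sum>\<alpha>\<in>UNIV. Im (u $ \<alpha>) * K3 h (im_part z) \<alpha> \<mu> \<nu>) * Re (W z $ \<mu> * cnj (w $ \<nu>)))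
      = (\<Sum>\<mu>\<in>UNIV. \<Sum>\<nu>\<in>UNIV. \<Sum>\<alpha>\<in>UNIV. K3 h (im_part z) \<alpha> \<mu> \<nu> * (Im (u $ \<alpha>) * Re (W z $ \<mu> * cnj (w $ \<nu>))))"
      unfolding sum_distrib_right by (simp only: ac_simps)
    also have "\<dots> = K_form_deriv h (im_part z) u (W z) w"
      unfolding K_form_deriv_def by (subst (2) sum.swap, subst sum.swap) simp
    finally show ?thesis
      by (simp only: sum.distrib K_form_def add.commute)
  qed
  ultimately show ?thesis by simp
qed

end

section \<open>Christoffel terms along coordinate axes\<close>

lemma sum_axis_left:
  fixes f :: "'m::finite \<Rightarrow> complex"
  shows "(\<Sum>\<mu>\<in>UNIV. f \<mu> * (axis \<alpha> a $ \<mu> * g \<mu>)) = f \<alpha> * (a * g \<alpha>)"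
proof -
  have "f \<mu> * (axis \<alpha> a $ \<mu> * g \<mu>) = (if \<mu> = \<alpha> then f \<alpha> * (a * g \<alpha>) else 0)" for \<mu>
    by (simp add: axis_def)
  then show ?thesis by simp
qed

lemma sum_axis_right:
  fixes f :: "'m::finite \<Rightarrow> complex"
  shows "(\<Sum>\<mu>\<in>UNIV. f \<mu> * (c * axis \<alpha> a $ \<mu>)) = f \<alpha> * (c * a)"
proof -
  have "f \<mu> * (c * axis \<alpha> a $ \<mu>) = (if \<mu> = \<alpha> then f \<alpha> * (c * a) else 0)" for \<mu>
    by (simp add: axis_def)
  then show ?thesis by simp
qed

lemma nabla_coord_axis_left:
  "nabla_coord h D x (axis \<mu> a) w $ \<rho> = - \<i> / 2 * (\<Sum>\<sigma>\<in>UNIV. of_real (christoffel h D x \<rho> \<mu> \<sigma>) * (a * w $ \<sigma>))"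
  unfolding nabla_coord_def by (subst sum.swap) (simp add: sum_axis_left)

lemma nabla_coord_axis_axis:
  "nabla_coord h D x (axis \<mu> a) (axis \<sigma> b) $ \<rho> = - \<i> / 2 * (of_real (christoffel h D x \<rho> \<mu> \<sigma>) * (a * b))"
  by (simp only: nabla_coord_axis_left sum_axis_right)

lemma nabla_coord_axis_nabla_coord:
  "nabla_coord h D x (axis \<mu> a) (nabla_coord h D x (axis \<nu> b) (axis \<sigma> c)) $ \<rho>
    = - (1 / 4) * (a * b * c) * of_real (\<Sum>\<kappa>\<in>UNIV. christoffel h D x \<rho> \<mu> \<kappa> * christoffel h D x \<kappa> \<nu> \<sigma>)"
  unfolding nabla_coord_axis_left[where w = "nabla_coord h D x (axis \<nu> b) (axis \<sigma> c)"] nabla_coord_axis_axis of_real_sum of_real_mult sum_distrib_left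
  by (intro sum.cong refl) (simp add: ac_simps)

locale r_map_connection = r_map_domain U h D
  for U :: "(real^'m::finite) set" and h D +
  fixes nabla :: "(complex^'m \<Rightarrow> complex^'m) \<Rightarrow> (complex^'m \<Rightarrow> complex^'m) \<Rightarrow> complex^'m \<Rightarrow> complex^'m"
  assumes lc: "levi_civita_on (tube_domain U) (r_map_metric h) nabla"
begin

abbreviation M :: "(complex^'m) set" where "M \<equiv> tube_domain U"

lemma open_M: "open M"
  by (rule open_tube_domain[OF open_U])

lemma im_part_in_U: "z \<in> M \<Longrightarrow> im_part z \<in> U"
  by (simp add: tube_domain_def)

lemma smooth_nabla: "smooth_on M X \<Longrightarrow> smooth_on M Y \<Longrightarrow> smooth_on M (nabla X Y)"
  using lc[unfolded levi_civita_on_def affine_connection_on_def, THEN conjunct1, THEN conjunct1] by simp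

lemma lie_bracket_const: "lie_bracket (\<lambda>_. u) (\<lambda>_. v) = (\<lambda>_. 0)"
  by (simp add: fun_eq_iff lie_bracket_def vderiv_def frechet_derivative_const)

lemma nabla_const_commute:
  assumes "z \<in> M"
  shows "nabla (\<lambda>_. u) (\<lambda>_. v) z = nabla (\<lambda>_. v) (\<lambda>_. u) z"
proof -
  have "nabla (\<lambda>_. u) (\<lambda>_. v) z - nabla (\<lambda>_. v) (\<lambda>_. u) z = lie_bracket (\<lambda>_. u) (\<lambda>_. v) z"
    using lc[unfolded levi_civita_on_def, THEN conjunct2, THEN conjunct1] assms
    by (simp add: smooth_on_const)
  then show ?thesis by (simp add: lie_bracket_const)
qed

text \<open>Metric compatibility with one constant argument w, which serves as a test
  vector.\<close>

lemma nabla_metric: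
  assumes z: "z \<in> M" and W: "smooth_on M W"
  shows "K_form h (im_part z) (nabla (\<lambda>_. u) W z) w + K_form h (im_part z) (W z) (nabla (\<lambda>_. u) (\<lambda>_. w) z)
    = K_form_deriv h (im_part z) u (W z) w + K_form h (im_part z) (frechet_derivative W (at z) u) w"
proof -
  have "vderiv (\<lambda>_. u) (\<lambda>q. r_map_metric h q (W q) w) z
      = r_map_metric h z (nabla (\<lambda>_. u) W z) w + r_map_metric h z (W z) (nabla (\<lambda>_. u) (\<lambda>_. w) z)"
    using lc[unfolded levi_civita_on_def, THEN conjunct2, THEN conjunct2, rule_format, of "\<lambda>_. u" W "\<lambda>_. w"] z W
    by (simp add: smooth_on_const)
  moreover have "vderiv (\<lambda>_. u) (\<lambda>q. r_map_metric h q (W q) w) z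
      = (K_form_deriv h (im_part z) u (W z) w + K_form h (im_part z) (frechet_derivative W (at z) u) w) / 2"
  proof -
    have "frechet_derivative (\<lambda>q. r_map_metric h q (W q) w) (at z)
      = frechet_derivative (\<lambda>q. K_form h (im_part q) (W q) w * (1 / 2)) (at z)"
      by (rule frechet_derivative_cong_open[OF open_M z]) (simp add: r_map_metric_eq)
    also have "\<dots> = (\<lambda>u. (K_form_deriv h (im_part z) u (W z) w
        + K_form h (im_part z) (frechet_derivative W (at z) u) w) * (1 / 2))"
      by (intro frechet_derivative_eqI has_derivative_mult_left has_derivative_K_form z
          differentiable_has_derivative smooth_on_differentiable[OF W z])
    finally show ?thesis by (simp add: vderiv_def)
  qed
  ultimately show ?thesis
    by (simp add: r_map_metric_eq[OF z])
qed

text \<open>The uniqueness argument for the Levi-Civita connection: brackets of constant fields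
  vanish, so compatibility for three arrangements of u, v, w determines the pairing of
  \<open>nabla\<close> with w.\<close>

lemma nabla_const:
  assumes z: "z \<in> M"
  shows "nabla (\<lambda>_. u) (\<lambda>_. v) z = nabla_coord h D (im_part z) u v"
proof -
  note x = im_part_in_U[OF z]
  let ?N = "\<lambda>u v. nabla (\<lambda>_. u) (\<lambda>_. v) z"
  have compat: "K_form h (im_part z) (?N u v) w + K_form h (im_part z) (?N u w) v = K_form_deriv h (im_part z) u v w"
    for u v w
  proof -
    have "K_form h (im_part z) (0 :: complex^'m) w = 0"
      by (simp add: K_form_def)
    then show ?thesis
      using nabla_metric[OF z smooth_on_const, of u v w] K_form_commute[OF x, of v]
      by (simp add: frechet_derivative_const)
  qed
  have "K_form h (im_part z) (?N u v - nabla_coord h D (im_part z) u v) w = 0" for w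
    using compat[of u v w] compat[of v u w] compat[of w u v] koszul_nabla_coord[OF x, of u v w]
      nabla_const_commute[OF z, of v u] nabla_const_commute[OF z, of w u] nabla_const_commute[OF z, of w v]
    unfolding K_form_diff_left by simp
  then have "?N u v - nabla_coord h D (im_part z) u v = 0"
    by (rule K_form_nondegenerate[OF x])
  then show ?thesis by simp
qed

text \<open>Needed for the outer covariant derivative in the curvature. Testing compatibility
  against constant w gives it directly, without expanding W in a basis.\<close>

lemma nabla_const_field:
  assumes z: "z \<in> M" and W: "smooth_on M W"
  shows "nabla (\<lambda>_. u) W z = frechet_derivative W (at z) u + nabla_coord h D (im_part z) u (W z)"
proof -
  note x = im_part_in_U[OF z]
  let ?A = "frechet_derivative W (at z) u + nabla_coord h D (im_part z) u (W z)"
  have "K_form h (im_part z) (nabla (\<lambda>_. u) W z - ?A) w = 0" for w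
    using nabla_metric[OF z W, of u w] K_form_deriv_compat[OF x, of u "W z" w]
    unfolding K_form_diff_left K_form_add_left nabla_const[OF z] by simp
  then have "nabla (\<lambda>_. u) W z - ?A = 0"
    by (rule K_form_nondegenerate[OF x])
  then show ?thesis by simp
qed

text \<open>The covariant derivatives of constant fields are smooth by assumption, so the differentiability
  of the inverse Hessian need not be proved separately.\<close>

lemma differentiable_christoffel:
  assumes x: "x \<in> U"
  shows "(\<lambda>x. christoffel h D x \<rho> \<mu> \<sigma>) differentiable (at x)"
proof -
  \<comment> \<open>A linear right inverse of \<open>im_part\<close>, along which differentiability
    on the tube domain is pulled back to U.\<close>
  define emb :: "real^'m \<Rightarrow> complex^'m" where "emb x = (\<chi> \<mu>. \<i> * of_real (x $ \<mu>))" for x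
  have emb: "bounded_linear emb"
    by (auto intro!: linearI
        simp: linear_conv_bounded_linear[symmetric] emb_def vec_eq_iff complex_eq_iff algebra_simps)
  have im_emb: "im_part (emb y) = y" for y
    by (simp add: emb_def im_part_def vec_eq_iff)
  then have emb_M: "emb y \<in> M" if "y \<in> U" for y
    using that by (simp add: tube_domain_def)
  define W where "W = nabla (\<lambda>_. axis \<mu> 1) (\<lambda>_. axis \<sigma> 1)"
  \<comment> \<open>On unit axis fields the component is \<open>- \<i> / 2\<close> times a real
    coefficient, which is recovered by the factor - 2 on its imaginary part.\<close>
  have christoffel_W: "- 2 * Im (W (emb y) $ \<rho>) = christoffel h D y \<rho> \<mu> \<sigma>" if "y \<in> U" for y
    unfolding W_def nabla_const[OF emb_M[OF that]] nabla_coord_axis_axis im_emb by simp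
  have "smooth_on M W"
    unfolding W_def by (intro smooth_nabla smooth_on_const)
  from differentiable_has_derivative[OF smooth_on_differentiable[OF this emb_M[OF x]]]
  have "((\<lambda>x. W (emb x)) has_derivative (\<lambda>v. frechet_derivative W (at (emb x)) (emb v))) (at x)"
    by (rule has_derivative_compose[OF bounded_linear_imp_has_derivative[OF emb]])
  then have "((\<lambda>x. - 2 * Im (W (emb x) $ \<rho>)) has_derivative
      (\<lambda>v. - 2 * Im (frechet_derivative W (at (emb x)) (emb v) $ \<rho>))) (at x)"
    by (intro has_derivative_mult_right has_derivative_Im bounded_linear.has_derivative[OF bounded_linear_vec_nth])
  then have "(\<lambda>x. - 2 * Im (W (emb x) $ \<rho>)) differentiable (at x)"
    by (rule differentiableI)
  from differentiable_cong_open[OF open_U x _ this] show ?thesis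
    using christoffel_W by simp
qed

text \<open>The inner field depends on x only, so its derivative along \<open>axis \<mu> a\<close>
  sees just Im a; the constant 1/4 with its sign is the square of \<open>- \<i> / 2\<close>.\<close>

lemma nabla_nabla_axis:
  assumes z: "z \<in> M"
  shows "nabla (\<lambda>_. axis \<mu> a) (nabla (\<lambda>_. axis \<nu> b) (\<lambda>_. axis \<sigma> c)) z $ \<rho>
    = - \<i> / 2 * (b * c) * of_real (Im a * pd \<mu> (\<lambda>x. christoffel h D x \<rho> \<nu> \<sigma>) (im_part z))
      - (1 / 4) * (a * b * c) * of_real (\<Sum>\<kappa>\<in>UNIV. christoffel h D (im_part z) \<rho> \<mu> \<kappa> * christoffel h D (im_part z) \<kappa> \<nu> \<sigma>)"
proof -
  define W where "W = nabla (\<lambda>_. axis \<nu> b) (\<lambda>_. axis \<sigma> c)"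
  have W: "smooth_on M W"
    unfolding W_def by (intro smooth_nabla smooth_on_const)
  have "frechet_derivative W (at z) u $ \<rho> = frechet_derivative (\<lambda>q. W q $ \<rho>) (at z) u" for u
    using frechet_derivative_eqI[OF bounded_linear.has_derivative[OF bounded_linear_vec_nth
        differentiable_has_derivative[OF smooth_on_differentiable[OF W z]]]] by metis
  also have "frechet_derivative (\<lambda>q. W q $ \<rho>) (at z)
     = frechet_derivative (\<lambda>q. (- \<i> / 2 * (b * c)) * of_real (christoffel h D (im_part q) \<rho> \<nu> \<sigma>)) (at z)"
    unfolding W_def
    by (rule frechet_derivative_cong_open[OF open_M z]) (simp add: nabla_const nabla_coord_axis_axis)
  also have "\<dots> = (\<lambda>v. - \<i> / 2 * (b * c) *
     of_real (\<Sum>\<alpha>\<in>UNIV. Im (v $ \<alpha>) * pd \<alpha> (\<lambda>x. christoffel h D x \<rho> \<nu> \<sigma>) (im_part z)))"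
    by (rule frechet_derivative_eqI[OF has_derivative_of_real_im_part[OF differentiable_christoffel[OF im_part_in_U[OF z]]]])
  finally have dW: "frechet_derivative W (at z) (axis \<mu> a) $ \<rho> = - \<i> / 2 * (b * c) *
     of_real (\<Sum>\<alpha>\<in>UNIV. Im (axis \<mu> a $ \<alpha>) * pd \<alpha> (\<lambda>x. christoffel h D x \<rho> \<nu> \<sigma>) (im_part z))" .
  have "Im (axis \<mu> a $ \<alpha>) * f \<alpha> = Im a * (f \<alpha> * kron \<alpha> \<mu>)" for \<alpha> and f :: "'m \<Rightarrow> real"
    by (simp add: axis_def kron_def)
  then have im: "(\<Sum>\<alpha>\<in>UNIV. Im (axis \<mu> a $ \<alpha>) * f \<alpha>) = Im a * f \<mu>" for f :: "'m \<Rightarrow> real"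
    by (simp only: sum_distrib_left[symmetric] sum_kron)
  show ?thesis
    unfolding W_def[symmetric] nabla_const_field[OF z W] vector_add_component dW im
    unfolding W_def nabla_const[OF z] nabla_coord_axis_nabla_coord by simp
qed

section \<open>Curvature on coordinate fields and its traces\<close>

lemma curvature_axis:
  assumes z: "z \<in> M"
  shows "curvature nabla (\<lambda>_. axis \<mu> a) (\<lambda>_. axis \<nu> b) (\<lambda>_. axis \<sigma> c) z $ \<rho>
    = - \<i> / 2 * c * (b * of_real (Im a * pd \<mu> (\<lambda>x. christoffel h D x \<rho> \<nu> \<sigma>) (im_part z))
         - a * of_real (Im b * pd \<nu> (\<lambda>x. christoffel h D x \<rho> \<mu> \<sigma>) (im_part z)))
      - (1 / 4) * (a * b * c) *
        of_real ((\<Sum>\<kappa>\<in>UNIV. christoffel h D (im_part z) \<rho> \<mu> \<kappa> * christoffel h D (im_part z) \<kappa> \<nu> \<sigma>)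
          - (\<Sum>\<kappa>\<in>UNIV. christoffel h D (im_part z) \<rho> \<nu> \<kappa> * christoffel h D (im_part z) \<kappa> \<mu> \<sigma>))"
proof -
  have "nabla (\<lambda>_. 0) (\<lambda>_. axis \<sigma> c) z = 0"
    by (simp add: nabla_const[OF z] nabla_coord_def vec_eq_iff)
  then show ?thesis
    unfolding curvature_def lie_bracket_const vector_minus_component nabla_nabla_axis[OF z]
    by (simp add: algebra_simps)
qed

text \<open>Applying \<open>dz\<close> identifies the two imaginary units. Complex linear slots then
  see 1, 0, 1 for \<open>field_z \<mu>\<close>, \<open>field_zbar \<nu>\<close>,
  \<open>field_z \<sigma>\<close>, which kills the products of Christoffel coefficients and the
  \<mu>-derivative. In the remaining term Im of the barred field becomes \<open>\<i> / 2\<close>;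
  together with the prefactor this gives - 1/4 times the \<nu>-derivative.\<close>

lemma Riem_eq:
  assumes z: "z \<in> M"
  shows "Riem nabla \<rho> \<sigma> \<mu> \<nu> z = of_real (riem_formula (im_part z) \<rho> \<sigma> \<mu> \<nu>)"
proof -
  have fields: "field_z \<mu> = ((\<lambda>_. axis \<mu> (1/2)), (\<lambda>_. axis \<mu> (- (\<i> / 2))))"
    "field_zbar \<mu> = ((\<lambda>_. axis \<mu> (1/2)), (\<lambda>_. axis \<mu> (\<i> / 2)))" for \<mu> :: 'm
    by (simp_all add: field_z_def field_zbar_def fun_eq_iff vec_eq_iff axis_def complex_eq_iff)
  let ?A = "pd \<mu> (\<lambda>x. christoffel h D x \<rho> \<nu> \<sigma>) (im_part z)"
  let ?B = "pd \<nu> (\<lambda>x. christoffel h D x \<rho> \<mu> \<sigma>) (im_part z)"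
  have "Riem nabla \<rho> \<sigma> \<mu> \<nu> z = of_real (- ?B / 4)"
    unfolding Riem_def fields dz_def curvature_complexified.simps Let_def fst_conv snd_conv
      vector_minus_component vector_add_component curvature_axis[OF z]
    by (simp add: complex_eq_iff algebra_simps)
  also have "- ?B / 4 = riem_formula (im_part z) \<rho> \<sigma> \<mu> \<nu>"
    by (intro pd_christoffel differentiable_christoffel im_part_in_U z)
  finally show ?thesis .
qed

lemma Ric_eq:
  assumes z: "z \<in> M"
  shows "Ric nabla \<mu> \<nu> z = of_real (\<Sum>\<rho>\<in>UNIV. riem_formula (im_part z) \<rho> \<mu> \<rho> \<nu>)"
  by (simp add: Ric_def Riem_eq[OF z])

lemma matrix_inv_kaehler_matrix:
  assumes z: "z \<in> M"
  shows "matrix_inv (kaehler_matrix h z) $ \<mu> $ \<nu> = of_real (4 * K2_inv h D (im_part z) \<mu> \<nu>)"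
proof -
  note x = im_part_in_U[OF z]
  let ?A = "kaehler_matrix h z"
  define B :: "complex^'m^'m" where "B = (\<chi> \<mu> \<nu>. of_real (4 * K2_inv h D (im_part z) \<mu> \<nu>))"
  have "(B ** ?A) $ \<rho> $ \<sigma> = mat 1 $ \<rho> $ \<sigma>" for \<rho> \<sigma>
  proof -
    have "(B ** ?A) $ \<rho> $ \<sigma> = of_real (\<Sum>\<tau>\<in>UNIV. K2_inv h D (im_part z) \<rho> \<tau> * K2 h (im_part z) \<tau> \<sigma>)"
      by (simp add: B_def matrix_matrix_mult_def kaehler_matrix_eq[OF z])
    then show ?thesis
      by (simp add: K2_inv_K2[OF x] mat_def kron_def)
  qed
  then have BA: "B ** ?A = mat 1"
    by (simp add: vec_eq_iff)
  then have AB: "?A ** B = mat 1"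
    by (simp add: matrix_left_right_inverse)
  have "\<exists>A'. ?A ** A' = mat 1 \<and> A' ** ?A = mat 1"
    using AB BA by blast
  then have "?A ** matrix_inv ?A = mat 1"
    unfolding matrix_inv_def by (rule someI2_ex) simp
  then have "matrix_inv ?A = B"
    by (metis BA matrix_mul_assoc matrix_mul_lid matrix_mul_rid)
  then show ?thesis by (simp add: B_def)
qed

lemma scal_eq:
  assumes z: "z \<in> M"
  shows "scal (kaehler_matrix h) nabla z = of_real
    (\<Sum>\<nu>\<in>UNIV. \<Sum>\<mu>\<in>UNIV. K2_inv h D (im_part z) \<nu> \<mu> * (4 * (\<Sum>\<rho>\<in>UNIV. riem_formula (im_part z) \<rho> \<mu> \<rho> \<nu>)))"
  unfolding scal_def Ric_eq[OF z] matrix_inv_kaehler_matrix[OF z]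
  by (subst sum.swap) (simp add: ac_simps)

end

theorem theorem3:
  fixes U :: "(real^'m::finite) set"
    and h :: "real^'m \<Rightarrow> real"
    and D :: real
    and nabla :: "(complex^'m \<Rightarrow> complex^'m) \<Rightarrow> (complex^'m \<Rightarrow> complex^'m) \<Rightarrow> complex^'m \<Rightarrow> complex^'m"
    and z :: "complex^'m" and x :: "real^'m" and m :: nat
  assumes "open U" and "connected U" and "U \<noteq> {}"
    and cone: "\<And>t x. t > 0 \<Longrightarrow> x \<in> U \<Longrightarrow> t *\<^sub>R x \<in> U"
    and pos: "\<And>x. x \<in> U \<Longrightarrow> h x > 0"
    and smooth: "smooth_on U h"
    and D: "D > 0" "D \<noteq> 1"
    and hom: "\<And>t x. t > 0 \<Longrightarrow> x \<in> U \<Longrightarrow> h (t *\<^sub>R x) = t powr D * h x"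
    and riem: "minus_hessian_riemannian_on_level U h"
    and lc: "levi_civita_on (tube_domain U) (r_map_metric h) nabla"
    and z: "z \<in> tube_domain U"
    and x_def: "x = im_part z"
    and m_def: "m = CARD('m)"
  shows
    "(\<forall>\<rho> \<sigma> \<mu> \<nu>. Riem nabla \<rho> \<sigma> \<mu> \<nu> z = complex_of_real
       (- 1 / (4 * (h x)^2) *
         (- ((h x)^2 * h_uddd h x \<rho> \<sigma> \<mu> \<nu>)
          + 1 / (D - 1) * x $ \<rho> * (h x * h3 h x \<sigma> \<mu> \<nu> - h2 h x \<mu> \<sigma> * h1 h x \<nu>)
          + h1 h x \<mu> * h1 h x \<nu> * kron \<rho> \<sigma>
          + h1 h x \<sigma> * h1 h x \<nu> * kron \<rho> \<mu>
          - h x * (h2 h x \<sigma> \<nu> * kron \<rho> \<mu> + h2 h x \<mu> \<nu> * kron \<rho> \<sigma>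
                   - 1 / (D - 1) * h2 h x \<mu> \<sigma> * kron \<rho> \<nu>)
          - (h x)^2 * (\<Sum>\<beta>\<in>UNIV. h_udd h x \<rho> \<nu> \<beta> * h_udd h x \<beta> \<sigma> \<mu>))))
    \<and>
    (\<forall>\<mu> \<nu>. Ric nabla \<mu> \<nu> z =
       - of_nat m * kaehler_matrix h z $ \<mu> $ \<nu>
       + complex_of_real (1/4 * (\<Sum>\<alpha>\<in>UNIV. \<Sum>\<beta>\<in>UNIV. h_duu h x \<mu> \<alpha> \<beta> * h3 h x \<alpha> \<beta> \<nu>)
                          + 1/4 * (\<Sum>\<rho>\<in>UNIV. h_uddd h x \<rho> \<rho> \<mu> \<nu>)))
    \<and>
    scal (kaehler_matrix h) nabla z = complex_of_real
       (- ((real m)^2) + (D - 2) / (D - 1) * real m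
        + h x * (\<Sum>\<alpha>\<in>UNIV. \<Sum>\<beta>\<in>UNIV. \<Sum>\<gamma>\<in>UNIV. h3 h x \<alpha> \<beta> \<gamma> * h_uuu h x \<alpha> \<beta> \<gamma>)
        + h x * (\<Sum>\<mu>\<in>UNIV. \<Sum>\<nu>\<in>UNIV. h_uudd h x \<mu> \<nu> \<mu> \<nu>))"
proof -
  interpret r_map_connection U h D nabla
    by standard (fact assms)+
  have x: "x \<in> U"
    using im_part_in_U[OF z] by (simp add: x_def)
  have Ric: "Ric nabla \<mu> \<nu> z =
       - of_nat m * kaehler_matrix h z $ \<mu> $ \<nu>
       + complex_of_real (1/4 * (\<Sum>\<alpha>\<in>UNIV. \<Sum>\<beta>\<in>UNIV. h_duu h x \<mu> \<alpha> \<beta> * h3 h x \<alpha> \<beta> \<nu>)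
                          + 1/4 * (\<Sum>\<rho>\<in>UNIV. h_uddd h x \<rho> \<rho> \<mu> \<nu>))" for \<mu> \<nu>
    unfolding Ric_eq[OF z] x_def contracted_riem_formula[OF im_part_in_U[OF z]] kaehler_matrix_eq[OF z]
    by (simp add: m_def)
  \<comment> \<open>The metric coefficients are \<open>K2 / 4\<close>, so their inverse carries a
    factor 4, which absorbs the quarters in the Ricci formula.\<close>
  have "4 * (\<Sum>\<rho>\<in>UNIV. riem_formula x \<rho> \<mu> \<rho> \<nu>) = - real CARD('m) * K2 h x \<mu> \<nu>
       + ((\<Sum>\<alpha>\<in>UNIV. \<Sum>\<beta>\<in>UNIV. h_duu h x \<mu> \<alpha> \<beta> * h3 h x \<alpha> \<beta> \<nu>)
       + (\<Sum>\<rho>\<in>UNIV. h_uddd h x \<rho> \<rho> \<mu> \<nu>))" for \<mu> \<nu>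
    unfolding contracted_riem_formula[OF x] by (simp add: algebra_simps)
  then have scal: "scal (kaehler_matrix h) nabla z = complex_of_real
       (- ((real m)^2) + (D - 2) / (D - 1) * real m
        + h x * (\<Sum>\<alpha>\<in>UNIV. \<Sum>\<beta>\<in>UNIV. \<Sum>\<gamma>\<in>UNIV. h3 h x \<alpha> \<beta> \<gamma> * h_uuu h x \<alpha> \<beta> \<gamma>)
        + h x * (\<Sum>\<mu>\<in>UNIV. \<Sum>\<nu>\<in>UNIV. h_uudd h x \<mu> \<nu> \<mu> \<nu>))"
    unfolding scal_eq[OF z] x_def[symmetric] m_def contracted_ricci[OF x, symmetric] by (simp only:)
  show ?thesis
    using Riem_eq[OF z] Ric scal unfolding riem_formula_def x_def[symmetric] by (intro conjI allI)
qed

end
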